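(* Let $f$ be a Hecke-holomorphic or Hecke-Maass cusp form for $\mathrm{SL}(2,\mathbb{Z})$ with normalized Fourier coefficients $\mathcal{A}_f(n)$. Let $k>1$ be a natural number, let $\delta_1\geqslant 1/2$, and let $\ell\in\mathbb{N}$ be the least natural number such that $2^{\ell+1}>k(1-\delta_1)$. Let $X\geqslant 1$ be a variable, let $\mathsf{S}\subset[X,2X]$ be a set of integers with $|\mathsf{S}|\asymp X^{1/k}$, and let $\mathsf{c}(n)$ be any complex sequence. Then for every $\varepsilon>0$, $$\sum_{X\leqslant n\leqslant 2X}\ \sum_{m\in\mathsf{S}}\mathsf{c}(n)\,\mathcal{A}_f(n+m)\ \ll_{f,\varepsilon}\ \|\mathsf{c}\|_2\,X^{1/2}\,\big(\|\gamma_\ell\|_2\big)^{1/2^{\ell+1}}\,X^{\frac{3}{2^{\ell+4}}-\frac{1}{4k}+\varepsilon},$$ where $$|\gamma_\ell(m)|=\#\Big\{(m_1,\dots,m_{2^{\ell+1}})\in\mathsf{S}^{2^{\ell+1}}:\ m=(m_1-m_2)+(m_3-m_4)+\cdots+(m_{2^{\ell+1}-1}-m_{2^{\ell+1}})\Big\}.$$ The implied constant depends on $f$ and $\varepsilon$ (and on the fixed parameters $k$, $\delta_1$ and the constants in $|\mathsf{S}|\asymp X^{1/k}$), but not on $X$, $\mathsf{S}$ or $\mathsf{c}$.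
   Context: Fourier coefficients: write $e(x)=e^{2\pi i x}$. If $f$ is a primitive holomorphic Hecke eigen-cusp form of integral weight $\kappa$ for $\mathrm{SL}(2,\mathbb{Z})$, the $\mathcal{A}_f(n)$ are defined by $f(z)=\sum_{n\geqslant 1}\mathcal{A}_f(n)n^{(\kappa-1)/2}e(nz)$ with $\mathcal{A}_f(1)=1$. If $f$ is a primitive Hecke-Maass cusp form for $\mathrm{SL}(2,\mathbb{Z})$ with Laplace eigenvalue $\tfrac14+\nu^2$, they are defined by $f(x+iy)=2\sqrt{y}\sum_{n\neq 0}\mathcal{A}_f(n)K_{i\nu}(2\pi|n|y)e(nx)$ with $\mathcal{A}_f(1)=1$, where $K_{i\nu}$ is the $K$-Bessel function. $\mathbb{N}=\{1,2,\dots\}$. $\|\cdot\|_2$ is the usual $\ell^2$-norm: $\|\mathsf{c}\|_2=\big(\sum_{X\leqslant n\leqslant 2X}|\mathsf{c}(n)|^2\big)^{1/2}$ and $\|\gamma_\ell\|_2=\big(\sum_{m\in\mathbb{Z}}|\gamma_\ell(m)|^2\big)^{1/2}$. $|\mathsf{S}|\asymp X^{1/k}$ means $c_1X^{1/k}\leqslant|\mathsf{S}|\leqslant c_2X^{1/k}$ for fixed constants $c_1,c_2>0$. *)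

theory Defs
  imports "HOL-Analysis.Analysis"
begin

definition uhp :: "complex set" where
  "uhp = {z. 0 < Im z}"

definition e_char :: "complex \<Rightarrow> complex" where
  "e_char z = exp (2 * of_real pi * \<i> * z)"

definition modular_of_weight :: "int \<Rightarrow> (complex \<Rightarrow> complex) \<Rightarrow> bool" where
  "modular_of_weight \<kappa> f \<longleftrightarrow>
     (\<forall>a b c d :: int. a * d - b * c = 1 \<longrightarrow>
        (\<forall>z\<in>uhp. f ((of_int a * z + of_int b) / (of_int c * z + of_int d))
                 = (of_int c * z + of_int d) powi \<kappa> * f z))"

text \<open>
  The factor \<open>n powr ((\<kappa> - 1) / 2)\<close> normalizes the operator so that its eigenvalue on a
  primitive form is the normalized Fourier coefficient \<open>A n\<close>; in weight 0 it is the
  usual \<open>1 / sqrt n\<close> for Maass forms.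
\<close>
definition hecke_op :: "int \<Rightarrow> nat \<Rightarrow> (complex \<Rightarrow> complex) \<Rightarrow> complex \<Rightarrow> complex" where
  "hecke_op \<kappa> n f z =
     of_real (real n powr ((of_int \<kappa> - 1) / 2)) *
     (\<Sum>d | d dvd n. of_nat d powi (- \<kappa>) *
        (\<Sum>b<d. f ((of_nat (n div d) * z + of_nat b) / of_nat d)))"

definition hecke_eigenfunction :: "int \<Rightarrow> (complex \<Rightarrow> complex) \<Rightarrow> bool" where
  "hecke_eigenfunction \<kappa> f \<longleftrightarrow> (\<forall>n\<ge>1. \<exists>\<mu>. \<forall>z\<in>uhp. hecke_op \<kappa> n f z = \<mu> * f z)"

definition hecke_holomorphic_cusp_form :: "int \<Rightarrow> (complex \<Rightarrow> complex) \<Rightarrow> bool" where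
  "hecke_holomorphic_cusp_form \<kappa> f \<longleftrightarrow>
     f holomorphic_on uhp \<and>
     modular_of_weight \<kappa> f \<and>
     (f \<longlongrightarrow> 0) (filtercomap Im at_top) \<and>
     hecke_eigenfunction \<kappa> f"

text \<open>
  In both cases below the coefficients are normalized by \<open>A 1 = 1\<close>. For holomorphic forms
  only the values of \<open>A\<close> at positive integers are meaningful.
\<close>
definition holomorphic_fourier_coeffs ::
    "int \<Rightarrow> (complex \<Rightarrow> complex) \<Rightarrow> (int \<Rightarrow> complex) \<Rightarrow> bool" where
  "holomorphic_fourier_coeffs \<kappa> f A \<longleftrightarrow>
     A 1 = 1 \<and>
     (\<forall>z\<in>uhp. ((\<lambda>n. A n * of_real (of_int n powr ((of_int \<kappa> - 1) / 2)) * e_char (of_int n * z))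
                 has_sum f z) {n::int. n \<ge> 1})"

definition dx :: "(complex \<Rightarrow> complex) \<Rightarrow> complex \<Rightarrow> complex" where
  "dx f z = vector_derivative (\<lambda>t. f (z + of_real t)) (at 0)"

definition dy :: "(complex \<Rightarrow> complex) \<Rightarrow> complex \<Rightarrow> complex" where
  "dy f z = vector_derivative (\<lambda>t. f (z + \<i> * of_real t)) (at 0)"

primrec C_on_uhp :: "nat \<Rightarrow> (complex \<Rightarrow> complex) \<Rightarrow> bool" where
  "C_on_uhp 0 f \<longleftrightarrow> continuous_on uhp f"
| "C_on_uhp (Suc r) f \<longleftrightarrow>
     (\<forall>z\<in>uhp. (\<lambda>t::real. f (z + of_real t)) differentiable (at 0) \<and>
              (\<lambda>t::real. f (z + \<i> * of_real t)) differentiable (at 0)) \<and>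
     C_on_uhp r (dx f) \<and> C_on_uhp r (dy f)"

definition hyperbolic_laplacian :: "(complex \<Rightarrow> complex) \<Rightarrow> complex \<Rightarrow> complex" where
  "hyperbolic_laplacian f z = - of_real ((Im z)\<^sup>2) * (dx (dx f) z + dy (dy f) z)"

text \<open>
  The spectral parameter \<open>\<nu>\<close> is complex, so that a hypothetical eigenvalue below 1/4 is not
  excluded by definition.
\<close>
definition hecke_maass_cusp_form :: "complex \<Rightarrow> (complex \<Rightarrow> complex) \<Rightarrow> bool" where
  "hecke_maass_cusp_form \<nu> f \<longleftrightarrow>
     (\<forall>r. C_on_uhp r f) \<and>
     modular_of_weight 0 f \<and>
     (\<forall>z\<in>uhp. hyperbolic_laplacian f z = (1/4 + \<nu>\<^sup>2) * f z) \<and>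
     (\<exists>N B. \<forall>z. Im z \<ge> 1 \<longrightarrow> norm (f z) \<le> B * Im z ^ N) \<and>
     (\<forall>y>0. integral {0..1} (\<lambda>x. f (Complex x y)) = 0) \<and>
     hecke_eigenfunction 0 f"

definition bessel_K :: "complex \<Rightarrow> real \<Rightarrow> complex" where
  "bessel_K s y = integral {0..} (\<lambda>t. of_real (exp (- y * cosh t)) * cosh (s * of_real t))"

definition maass_fourier_coeffs ::
    "complex \<Rightarrow> (complex \<Rightarrow> complex) \<Rightarrow> (int \<Rightarrow> complex) \<Rightarrow> bool" where
  "maass_fourier_coeffs \<nu> f A \<longleftrightarrow>
     A 1 = 1 \<and>
     (\<forall>x y. y > 0 \<longrightarrow>
        ((\<lambda>n. 2 * of_real (sqrt y) *
              (A n * bessel_K (\<i> * \<nu>) (2 * pi * of_int \<bar>n\<bar> * y) * e_char (of_int n * of_real x)))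
          has_sum f (Complex x y)) {n::int. n \<noteq> 0})"

definition dyadic_ints :: "real \<Rightarrow> int set" where
  "dyadic_ints X = {n. X \<le> of_int n \<and> of_int n \<le> 2 * X}"

text \<open>
  The tuple entries are indexed from 0, so \<open>t (2 * j)\<close> and \<open>t (2 * j + 1)\<close> are the entries
  with plus and minus sign respectively.
\<close>
definition gamma_count :: "int set \<Rightarrow> nat \<Rightarrow> int \<Rightarrow> nat" where
  "gamma_count S l m =
     card {t \<in> {..<(2::nat) ^ (l + 1)} \<rightarrow>\<^sub>E S. m = (\<Sum>j<2 ^ l. t (2 * j) - t (2 * j + 1))}"

definition gamma_norm :: "int set \<Rightarrow> nat \<Rightarrow> real" where
  "gamma_norm S l = sqrt (\<Sum>\<^sub>\<infinity>m\<in>UNIV. (real (gamma_count S l m))\<^sup>2)"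

definition seq_norm :: "real \<Rightarrow> (int \<Rightarrow> complex) \<Rightarrow> real" where
  "seq_norm X c = sqrt (\<Sum>n\<in>dyadic_ints X. (norm (c n))\<^sup>2)"

end

theory Submission imports Defs begin

text \<open>
  The double sum is a bilinear form in \<open>c\<close> and the indicator function of \<open>S\<close> with the Hankel matrix
  \<open>A (n + m)\<close>, where \<open>n\<close> and \<open>m\<close> range over \<open>[X, 2 X]\<close>. The heart of the proof is that this matrix
  has norm \<open>O (sqrt X)\<close>, so that the sum is \<open>O (seq_norm X c * sqrt X * sqrt (card S))\<close>.

  A Hankel matrix whose entries are the Fourier coefficients of a function bounded by \<open>C\<close> has norm at
  most \<open>C\<close> (\<open>bilinear_bound_fourier_series\<close>). The functions used are the restrictions of \<open>f\<close> to
  horizontal lines at height about \<open>1 / X\<close>; \<open>y powr (\<kappa> / 2) * norm (f z)\<close> is invariant under the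
  modular group and small near the cusp, hence bounded. Their coefficients are \<open>A n\<close> times a
  weight, and the problem is to remove a weight that depends on \<open>n + m\<close>. A product of a function of
  \<open>n\<close> and a function of \<open>m\<close> is harmless, so it is enough to reach exponentials:

  \<^item> For a holomorphic form the weight is an exponential times a power of \<open>n + m\<close>, and the inverse
    power is an average of exponentials by the Gamma integral (\<open>holomorphic_hankel_bound\<close>).

  \<^item> For a Maass form the weight is a Bessel function, itself an average of exponentials
    \<open>exp (- u * cosh t)\<close>. It does not have to be inverted: on a block where \<open>u\<close> stays close to a point \<open>U\<close>
    that is not a zero, the deviation of the weight from its value at \<open>U\<close> costs at most half
    the norm sought and is absorbed. A bounded number of blocks suffices (\<open>maass_hankel_bound\<close>).

  It remains to compare \<open>sqrt (card S)\<close> with the power of \<open>gamma_norm S l\<close> (\<open>sqrt_card_bound\<close>). The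
  diagonal solutions give \<open>sqrt (card S) \<le> gamma_norm S l powr (1 / 2 ^ (l + 1))\<close>, which suffices when
  the remaining exponent \<open>3 / 2 ^ (l + 4) - 1 / (4 * k)\<close> is nonnegative. By the minimality of \<open>l\<close> this
  only fails for \<open>k = 2\<close> and \<open>l = 1\<close>. Then \<open>card S\<close> is at least of order \<open>sqrt X\<close>, and the number of solutions
  predicted by Cauchy-Schwarz, of order \<open>card S ^ 8 / X\<close>, is large enough.
\<close>

section \<open>Norm bounds for bilinear forms\<close>

text \<open>
  The number \<open>\<beta>\<close> bounds the operator norm of the matrix \<open>B\<close> with rows \<open>D\<close> and columns \<open>E\<close>.
  Bounds are handled as a predicate because only upper bounds on norms are ever combined.
\<close>
definition bilinear_bound ::
    "int set \<Rightarrow> int set \<Rightarrow> (int \<Rightarrow> int \<Rightarrow> complex) \<Rightarrow> real \<Rightarrow> bool" where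
  "bilinear_bound D E B \<beta> \<longleftrightarrow>
     (\<forall>c d. norm (\<Sum>n\<in>D. \<Sum>m\<in>E. c n * d m * B n m)
              \<le> \<beta> * L2_set (\<lambda>n. norm (c n)) D * L2_set (\<lambda>m. norm (d m)) E)"

lemma bilinear_boundI:
  assumes "\<And>c d. norm (\<Sum>n\<in>D. \<Sum>m\<in>E. c n * d m * B n m)
              \<le> \<beta> * L2_set (\<lambda>n. norm (c n)) D * L2_set (\<lambda>m. norm (d m)) E"
  shows "bilinear_bound D E B \<beta>"
  using assms unfolding bilinear_bound_def by blast

lemma bilinear_boundD:
  assumes "bilinear_bound D E B \<beta>"
  shows "norm (\<Sum>n\<in>D. \<Sum>m\<in>E. c n * d m * B n m)
              \<le> \<beta> * L2_set (\<lambda>n. norm (c n)) D * L2_set (\<lambda>m. norm (d m)) E"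
  using assms unfolding bilinear_bound_def by blast

lemma bilinear_bound_cong:
  assumes "bilinear_bound D E B \<beta>" "\<And>n m. n \<in> D \<Longrightarrow> m \<in> E \<Longrightarrow> B n m = B' n m" "\<beta> = \<beta>'"
  shows "bilinear_bound D E B' \<beta>'"
proof (rule bilinear_boundI)
  fix c d :: "int \<Rightarrow> complex"
  have "(\<Sum>n\<in>D. \<Sum>m\<in>E. c n * d m * B' n m) = (\<Sum>n\<in>D. \<Sum>m\<in>E. c n * d m * B n m)"
    by (intro sum.cong) (use assms(2) in auto)
  then show "norm (\<Sum>n\<in>D. \<Sum>m\<in>E. c n * d m * B' n m)
      \<le> \<beta>' * L2_set (\<lambda>n. norm (c n)) D * L2_set (\<lambda>m. norm (d m)) E"
    using bilinear_boundD[OF assms(1), of c d] assms(3) by simp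
qed

lemma bilinear_bound_mono:
  assumes "bilinear_bound D E B \<beta>" "\<beta> \<le> \<beta>'"
  shows "bilinear_bound D E B \<beta>'"
proof (rule bilinear_boundI)
  fix c d :: "int \<Rightarrow> complex"
  have "\<beta> * L2_set (\<lambda>n. norm (c n)) D * L2_set (\<lambda>m. norm (d m)) E
     \<le> \<beta>' * L2_set (\<lambda>n. norm (c n)) D * L2_set (\<lambda>m. norm (d m)) E"
    by (intro mult_right_mono assms) auto
  then show "norm (\<Sum>n\<in>D. \<Sum>m\<in>E. c n * d m * B n m)
      \<le> \<beta>' * L2_set (\<lambda>n. norm (c n)) D * L2_set (\<lambda>m. norm (d m)) E"
    using bilinear_boundD[OF assms(1), of c d] by linarith
qed

lemma bilinear_bound_add:
  assumes "bilinear_bound D E B \<beta>" "bilinear_bound D E B' \<beta>'"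
  shows "bilinear_bound D E (\<lambda>n m. B n m + B' n m) (\<beta> + \<beta>')"
proof (rule bilinear_boundI)
  fix c d :: "int \<Rightarrow> complex"
  have "(\<Sum>n\<in>D. \<Sum>m\<in>E. c n * d m * (B n m + B' n m))
     = (\<Sum>n\<in>D. \<Sum>m\<in>E. c n * d m * B n m) + (\<Sum>n\<in>D. \<Sum>m\<in>E. c n * d m * B' n m)"
    by (simp add: sum.distrib algebra_simps)
  also have "norm \<dots> \<le> norm (\<Sum>n\<in>D. \<Sum>m\<in>E. c n * d m * B n m) +
      norm (\<Sum>n\<in>D. \<Sum>m\<in>E. c n * d m * B' n m)"
    by (rule norm_triangle_ineq)
  also have "\<dots> \<le> (\<beta> + \<beta>') * L2_set (\<lambda>n. norm (c n)) D * L2_set (\<lambda>m. norm (d m)) E"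
    using bilinear_boundD[OF assms(1), of c d] bilinear_boundD[OF assms(2), of c d]
    by (simp add: algebra_simps)
  finally show "norm (\<Sum>n\<in>D. \<Sum>m\<in>E. c n * d m * (B n m + B' n m))
      \<le> (\<beta> + \<beta>') * L2_set (\<lambda>n. norm (c n)) D * L2_set (\<lambda>m. norm (d m)) E" .
qed

lemma L2_set_weighted_le:
  assumes "\<And>n. n \<in> D \<Longrightarrow> norm (p n) \<le> P" "0 \<le> P"
  shows "L2_set (\<lambda>n. norm (c n * p n :: complex)) D \<le> P * L2_set (\<lambda>n. norm (c n)) D"
proof -
  have "L2_set (\<lambda>n. norm (c n * p n)) D \<le> L2_set (\<lambda>n. P * norm (c n)) D"
    by (intro L2_set_mono) (use assms in \<open>auto simp: norm_mult mult.commute[of P] intro!: mult_left_mono\<close>)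
  then show ?thesis
    using assms by (simp add: L2_set_right_distrib)
qed

text \<open>
  A weight that is a product of a function of \<open>n\<close> and a function of \<open>m\<close> can be moved into the
  vectors \<open>c\<close> and \<open>d\<close>. All weights below are removed by writing them through such products.
\<close>
lemma bilinear_bound_weight:
  assumes "bilinear_bound D E B \<beta>" "0 \<le> \<beta>"
    and "\<And>n. n \<in> D \<Longrightarrow> norm (p n) \<le> P" "0 \<le> P"
    and "\<And>m. m \<in> E \<Longrightarrow> norm (q m) \<le> Q" "0 \<le> Q"
  shows "bilinear_bound D E (\<lambda>n m. p n * q m * B n m) (P * Q * \<beta>)"
proof (rule bilinear_boundI)
  fix c d :: "int \<Rightarrow> complex"
  have "norm (\<Sum>n\<in>D. \<Sum>m\<in>E. c n * d m * (p n * q m * B n m))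
      = norm (\<Sum>n\<in>D. \<Sum>m\<in>E. (c n * p n) * (d m * q m) * B n m)"
    by (simp add: mult_ac)
  also have "\<dots> \<le> \<beta> * L2_set (\<lambda>n. norm (c n * p n)) D * L2_set (\<lambda>m. norm (d m * q m)) E"
    by (rule bilinear_boundD[OF assms(1)])
  also have "\<dots> \<le> \<beta> * (P * L2_set (\<lambda>n. norm (c n)) D) * (Q * L2_set (\<lambda>m. norm (d m)) E)"
    by (intro mult_mono L2_set_weighted_le) (use assms in auto)
  finally show "norm (\<Sum>n\<in>D. \<Sum>m\<in>E. c n * d m * (p n * q m * B n m))
     \<le> P * Q * \<beta> * L2_set (\<lambda>n. norm (c n)) D * L2_set (\<lambda>m. norm (d m)) E"
    by (simp add: mult_ac)
qed

lemma bilinear_bound_scale: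
  assumes "bilinear_bound D E B \<beta>" "0 \<le> \<beta>"
  shows "bilinear_bound D E (\<lambda>n m. z * B n m) (norm z * \<beta>)"
  using bilinear_bound_weight[OF assms, of "\<lambda>_. z" "norm z" "\<lambda>_. 1" 1] by simp

text \<open>
  Every finite matrix has some bound, from which the iteration in \<open>bilinear_bound_divide_weight\<close>
  can start.
\<close>
lemma bilinear_bound_finite:
  assumes "finite D" "finite E"
  shows "bilinear_bound D E B (\<Sum>n\<in>D. \<Sum>m\<in>E. norm (B n m))"
proof (rule bilinear_boundI)
  fix c d :: "int \<Rightarrow> complex"
  let ?L = "L2_set (\<lambda>n. norm (c n)) D * L2_set (\<lambda>m. norm (d m)) E"
  have "norm (\<Sum>n\<in>D. \<Sum>m\<in>E. c n * d m * B n m)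
      \<le> (\<Sum>n\<in>D. \<Sum>m\<in>E. norm (c n * d m * B n m))"
    by (intro order.trans[OF norm_sum] sum_mono) auto
  also have "\<dots> \<le> (\<Sum>n\<in>D. \<Sum>m\<in>E. ?L * norm (B n m))"
    using member_le_L2_set[OF assms(1), of _ "\<lambda>n. norm (c n)"]
      member_le_L2_set[OF assms(2), of _ "\<lambda>m. norm (d m)"]
    by (intro sum_mono) (auto simp: norm_mult intro!: mult_mono)
  finally show "norm (\<Sum>n\<in>D. \<Sum>m\<in>E. c n * d m * B n m)
     \<le> (\<Sum>n\<in>D. \<Sum>m\<in>E. norm (B n m)) * L2_set (\<lambda>n. norm (c n)) D * L2_set (\<lambda>m. norm (d m)) E"
    by (simp add: sum_distrib_left mult_ac)
qed

lemma bilinear_bound_limit: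
  assumes "\<And>k. bilinear_bound D E B (\<beta> k)" "\<beta> \<longlonglongrightarrow> b"
  shows "bilinear_bound D E B b"
proof (rule bilinear_boundI)
  fix c d :: "int \<Rightarrow> complex"
  let ?L1 = "L2_set (\<lambda>n. norm (c n)) D" and ?L2 = "L2_set (\<lambda>m. norm (d m)) E"
  have "(\<lambda>k. \<beta> k * ?L1 * ?L2) \<longlonglongrightarrow> b * ?L1 * ?L2"
    by (intro tendsto_intros assms)
  then show "norm (\<Sum>n\<in>D. \<Sum>m\<in>E. c n * d m * B n m) \<le> b * ?L1 * ?L2"
    by (rule LIMSEQ_le_const) (use bilinear_boundD[OF assms(1)] in blast)
qed

text \<open>
  Averages of matrices obey the averaged bound. This turns an integral representation of a weight
  of \<open>n + m\<close> by exponentials, each of which is a product weight, into a bound.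
\<close>
lemma bilinear_bound_integral:
  fixes T :: "real set"
  assumes fin: "finite D" "finite E"
    and bd: "\<And>t. t \<in> T \<Longrightarrow> bilinear_bound D E (K t) (\<beta> t)"
    and K: "\<And>n m. n \<in> D \<Longrightarrow> m \<in> E \<Longrightarrow> (\<lambda>t. K t n m) integrable_on T"
    and \<beta>: "\<beta> integrable_on T"
  shows "bilinear_bound D E (\<lambda>n m. integral T (\<lambda>t. K t n m)) (integral T \<beta>)"
proof (rule bilinear_boundI)
  fix c d :: "int \<Rightarrow> complex"
  let ?L = "L2_set (\<lambda>n. norm (c n)) D * L2_set (\<lambda>m. norm (d m)) E"
  have int: "(\<lambda>t. c n * d m * K t n m) integrable_on T" if "n \<in> D" "m \<in> E" for n m
    by (rule integrable_on_mult_right[OF K[OF that]])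
  have "(\<Sum>n\<in>D. \<Sum>m\<in>E. c n * d m * integral T (\<lambda>t. K t n m))
      = (\<Sum>n\<in>D. \<Sum>m\<in>E. integral T (\<lambda>t. c n * d m * K t n m))"
    by (simp add: integral_mult_right)
  also have "\<dots> = (\<Sum>n\<in>D. integral T (\<lambda>t. \<Sum>m\<in>E. c n * d m * K t n m))"
    by (intro sum.cong refl integral_sum[symmetric] fin int) auto
  also have "\<dots> = integral T (\<lambda>t. \<Sum>n\<in>D. \<Sum>m\<in>E. c n * d m * K t n m)"
    by (intro integral_sum[symmetric] fin int integrable_sum) auto
  also have "norm \<dots> \<le> integral T (\<lambda>t. \<beta> t * ?L)"
    using bilinear_boundD[OF bd]
    by (intro integral_norm_bound_integral integrable_sum fin int
         integrable_on_mult_left[OF \<beta>]) (auto simp: mult.assoc)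
  also have "\<dots> = integral T \<beta> * ?L"
    by (simp add: integral_mult_left)
  finally show "norm (\<Sum>n\<in>D. \<Sum>m\<in>E. c n * d m * integral T (\<lambda>t. K t n m))
      \<le> integral T \<beta> * L2_set (\<lambda>n. norm (c n)) D * L2_set (\<lambda>m. norm (d m)) E"
    by (simp add: mult.assoc)
qed

text \<open>
  Dividing by a weight \<open>w\<close> that is nearly constant. If \<open>\<beta>\<close> bounds \<open>B\<close>, then
  \<open>z B = B w - B (w - z)\<close> shows that \<open>\<alpha> / norm z + \<beta> / 2\<close> bounds \<open>B\<close> too. Iterating from any
  finite bound converges to the fixed point \<open>2 \<alpha> / norm z\<close>. The point is that only \<open>w\<close>, and not
  \<open>1 / w\<close>, has to be an average of product weights.
\<close>
lemma bilinear_bound_divide_weight: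
  assumes fin: "finite D" "finite E"
    and w: "bilinear_bound D E (\<lambda>n m. B n m * w n m) \<alpha>" and \<alpha>: "0 \<le> \<alpha>" and z: "z \<noteq> 0"
    and small: "\<And>\<beta>. 0 \<le> \<beta> \<Longrightarrow> bilinear_bound D E B \<beta> \<Longrightarrow>
        bilinear_bound D E (\<lambda>n m. B n m * (w n m - z)) (\<beta> * (norm z / 2))"
  shows "bilinear_bound D E B (2 * \<alpha> / norm z)"
proof -
  have step: "bilinear_bound D E B (\<alpha> / norm z + \<beta> / 2)" if "0 \<le> \<beta>" "bilinear_bound D E B \<beta>" for \<beta>
  proof -
    have 1: "bilinear_bound D E (\<lambda>n m. (1 / z) * (B n m * w n m)) (norm (1 / z) * \<alpha>)"
      by (rule bilinear_bound_scale[OF w \<alpha>])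
    have 2: "bilinear_bound D E (\<lambda>n m. (- 1 / z) * (B n m * (w n m - z)))
               (norm (- 1 / z) * (\<beta> * (norm z / 2)))"
      using that by (intro bilinear_bound_scale small) auto
    show ?thesis
      by (rule bilinear_bound_cong[OF bilinear_bound_add[OF 1 2]])
         (use z in \<open>auto simp: field_simps norm_divide\<close>)
  qed
  define \<beta>\<^sub>0 where "\<beta>\<^sub>0 = (\<Sum>n\<in>D. \<Sum>m\<in>E. norm (B n m))"
  define b where "b k = ((\<lambda>\<beta>. \<alpha> / norm z + \<beta> / 2) ^^ k) \<beta>\<^sub>0" for k
  have b: "0 \<le> b k \<and> bilinear_bound D E B (b k)" for k
  proof (induction k)
    case 0
    then show ?case
      using bilinear_bound_finite[OF fin, of B] by (auto simp: b_def \<beta>\<^sub>0_def intro!: sum_nonneg)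
  next
    case (Suc k)
    then show ?case using step[of "b k"] \<alpha> by (auto simp: b_def)
  qed
  have eq: "b k = 2 * \<alpha> / norm z + (\<beta>\<^sub>0 - 2 * \<alpha> / norm z) * (1 / 2) ^ k" for k
  proof (induction k)
    case (Suc k)
    have "b (Suc k) = \<alpha> / norm z + b k / 2" by (simp add: b_def)
    then show ?case unfolding Suc.IH by (simp add: algebra_simps add_divide_distrib diff_divide_distrib)
  qed (simp add: b_def)
  have "b \<longlonglongrightarrow> 2 * \<alpha> / norm z + (\<beta>\<^sub>0 - 2 * \<alpha> / norm z) * 0"
    unfolding eq by (intro tendsto_intros LIMSEQ_realpow_zero) auto
  then show ?thesis
    using bilinear_bound_limit[of D E B b] b by simp
qed

lemma L2_set_subset_le:
  assumes "finite D" "D' \<subseteq> D"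
  shows "L2_set f D' \<le> L2_set f D"
  unfolding L2_set_def by (intro real_sqrt_le_mono sum_mono2) (use assms in auto)

text \<open>
  The crude loss of a factor \<open>card P\<close> for rows and for columns is harmless: the number of blocks
  will be independent of \<open>X\<close>.
\<close>
lemma bilinear_bound_partition:
  assumes fin: "finite D" "finite E" and P: "finite P" "blk ` (D \<union> E) \<subseteq> P" and \<beta>: "0 \<le> \<beta>"
    and bd: "\<And>p q. p \<in> P \<Longrightarrow> q \<in> P \<Longrightarrow>
       bilinear_bound {n \<in> D. blk n = p} {m \<in> E. blk m = q} B \<beta>"
  shows "bilinear_bound D E B ((real (card P))\<^sup>2 * \<beta>)"
proof (rule bilinear_boundI)
  fix c d :: "int \<Rightarrow> complex"
  let ?D = "\<lambda>p. {n \<in> D. blk n = p}" and ?E = "\<lambda>q. {m \<in> E. blk m = q}"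
  let ?L1 = "L2_set (\<lambda>n. norm (c n)) D" and ?L2 = "L2_set (\<lambda>m. norm (d m)) E"
  have grpE: "(\<Sum>m\<in>E. g m) = (\<Sum>q\<in>P. \<Sum>m\<in>?E q. g m)" for g :: "int \<Rightarrow> complex"
    by (rule sum.group[symmetric]) (use fin P in auto)
  have grpD: "(\<Sum>m\<in>D. g m) = (\<Sum>q\<in>P. \<Sum>m\<in>?D q. g m)" for g :: "int \<Rightarrow> complex"
    by (rule sum.group[symmetric]) (use fin P in auto)
  have "(\<Sum>n\<in>D. \<Sum>m\<in>E. c n * d m * B n m)
      = (\<Sum>p\<in>P. \<Sum>n\<in>?D p. \<Sum>q\<in>P. \<Sum>m\<in>?E q. c n * d m * B n m)"
    unfolding grpE grpD ..
  also have "\<dots> = (\<Sum>p\<in>P. \<Sum>q\<in>P. \<Sum>n\<in>?D p. \<Sum>m\<in>?E q. c n * d m * B n m)"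
    by (intro sum.cong refl sum.swap)
  also have "norm \<dots> \<le> (\<Sum>p\<in>P. \<Sum>q\<in>P. norm (\<Sum>n\<in>?D p. \<Sum>m\<in>?E q. c n * d m * B n m))"
    by (rule order.trans[OF norm_sum], intro sum_mono norm_sum)
  also have "\<dots> \<le> (\<Sum>p\<in>P. \<Sum>q\<in>P. \<beta> * ?L1 * ?L2)"
  proof (intro sum_mono)
    fix p q assume pq: "p \<in> P" "q \<in> P"
    have "norm (\<Sum>n\<in>?D p. \<Sum>m\<in>?E q. c n * d m * B n m)
       \<le> \<beta> * L2_set (\<lambda>n. norm (c n)) (?D p) * L2_set (\<lambda>m. norm (d m)) (?E q)"
      by (rule bilinear_boundD[OF bd[OF pq]])
    also have "\<dots> \<le> \<beta> * ?L1 * ?L2"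
      by (intro mult_mono L2_set_subset_le) (use fin \<beta> in auto)
    finally show "norm (\<Sum>n\<in>?D p. \<Sum>m\<in>?E q. c n * d m * B n m) \<le> \<beta> * ?L1 * ?L2" .
  qed
  finally show "norm (\<Sum>n\<in>D. \<Sum>m\<in>E. c n * d m * B n m) \<le> (real (card P))\<^sup>2 * \<beta> * ?L1 * ?L2"
    by (simp add: power2_eq_square mult_ac)
qed

section \<open>Hankel forms of bounded Fourier series\<close>

lemma sum_cis_roots:
  fixes r :: int and Q :: nat
  assumes "\<bar>r\<bar> < int Q"
  shows "(\<Sum>j<Q. cis (2 * pi * of_int r * (real j / real Q))) = (if r = 0 then of_nat Q else 0)"
proof (cases "r = 0")
  case False
  define z where "z = cis (2 * pi * of_int r / real Q)"
  have Q: "Q > 0" using assms by auto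
  have "z \<noteq> 1"
  proof
    assume "z = 1"
    then obtain k :: int where "2 * pi * of_int r / real Q = of_int k * 2 * pi"
      by (auto simp: z_def complex_eq_iff cos_one_2pi_int)
    then have "of_int r = (of_int (k * int Q) :: real)"
      using Q by (simp add: field_simps)
    then have "r = k * int Q" by linarith
    then show False
      using assms False by (auto simp: abs_mult mult_less_cancel_right1 split: if_splits)
  qed
  have "(\<Sum>j<Q. cis (2 * pi * of_int r * (real j / real Q))) = (\<Sum>j<Q. z ^ j)"
    by (intro sum.cong refl) (simp add: z_def Complex.DeMoivre mult_ac)
  also have "\<dots> = (z ^ Q - 1) / (z - 1)"
    using \<open>z \<noteq> 1\<close> by (rule geometric_sum)
  also have "z ^ Q = cis (2 * pi * of_int r)"
    using Q by (simp add: z_def Complex.DeMoivre)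
  also have "\<dots> = 1" by (intro cis_multiple_2pi) auto
  finally show ?thesis using False by simp
qed simp

definition trig_sum :: "int set \<Rightarrow> (int \<Rightarrow> complex) \<Rightarrow> real \<Rightarrow> complex" where
  "trig_sum D c x = (\<Sum>n\<in>D. c n * cis (2 * pi * of_int n * x))"

text \<open>
  Sampling at the points \<open>j / Q\<close> instead of integrating keeps all sums finite; the identity is exact
  as soon as the frequencies are distinct modulo \<open>Q\<close>.
\<close>
lemma trig_sum_parseval:
  assumes D: "finite D" "\<And>n n'. n \<in> D \<Longrightarrow> n' \<in> D \<Longrightarrow> \<bar>n - n'\<bar> < int Q"
  shows "L2_set (\<lambda>j. norm (trig_sum D c (real j / real Q))) {..<Q}
           = sqrt (real Q) * L2_set (\<lambda>n. norm (c n)) D"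
proof -
  let ?x = "\<lambda>j. real j / real Q"
  have "complex_of_real (\<Sum>j<Q. (norm (trig_sum D c (?x j)))\<^sup>2)
      = (\<Sum>j<Q. trig_sum D c (?x j) * cnj (trig_sum D c (?x j)))"
    unfolding of_real_sum by (intro sum.cong refl complex_norm_square)
  also have "\<dots> = (\<Sum>j<Q. \<Sum>n\<in>D. \<Sum>n'\<in>D. c n * cnj (c n') * cis (2 * pi * of_int (n - n') * ?x j))"
    by (intro sum.cong refl)
       (simp add: trig_sum_def sum_product cnj_sum cis_cnj cis_mult algebra_simps)
  also have "\<dots> = (\<Sum>n\<in>D. \<Sum>j<Q. \<Sum>n'\<in>D. c n * cnj (c n') * cis (2 * pi * of_int (n - n') * ?x j))"
    by (rule sum.swap)
  also have "\<dots> = (\<Sum>n\<in>D. \<Sum>n'\<in>D. c n * cnj (c n') * (\<Sum>j<Q. cis (2 * pi * of_int (n - n') * ?x j)))"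
    unfolding sum_distrib_left by (intro sum.cong refl sum.swap)
  also have "\<dots> = (\<Sum>n\<in>D. \<Sum>n'\<in>D. c n * cnj (c n') * (if n - n' = 0 then of_nat Q else 0))"
    by (intro sum.cong refl arg_cong2[where f = "(*)"] sum_cis_roots D)
  also have "\<dots> = (\<Sum>n\<in>D. c n * cnj (c n) * of_nat Q)"
    using D(1) by (intro sum.cong refl) (simp add: if_distrib[of "\<lambda>u. _ * u"] cong: if_cong)
  also have "\<dots> = complex_of_real (real Q * (\<Sum>n\<in>D. (norm (c n))\<^sup>2))"
    by (simp add: sum_distrib_left complex_norm_square[symmetric] mult_ac)
  finally have "(\<Sum>j<Q. (norm (trig_sum D c (?x j)))\<^sup>2) = real Q * (\<Sum>n\<in>D. (norm (c n))\<^sup>2)"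
    by (simp only: of_real_eq_iff)
  then show ?thesis
    by (simp add: L2_set_def real_sqrt_mult)
qed

lemma trig_sum_triple_average:
  assumes fin: "finite D" "finite E" "finite T"
    and Q: "\<And>n m t. n \<in> D \<Longrightarrow> m \<in> E \<Longrightarrow> t \<in> T \<Longrightarrow> \<bar>n + m - t\<bar> < int Q"
    and T: "\<And>n m. n \<in> D \<Longrightarrow> m \<in> E \<Longrightarrow> n + m \<in> T"
  shows "(\<Sum>j<Q. trig_sum D c (real j / real Q) * trig_sum E d (real j / real Q) *
             trig_sum T a (- (real j / real Q)))
         = of_nat Q * (\<Sum>n\<in>D. \<Sum>m\<in>E. c n * d m * a (n + m))"
proof -
  let ?x = "\<lambda>j. real j / real Q"
  have triple: "sum f D * sum g E * sum h T = (\<Sum>n\<in>D. \<Sum>m\<in>E. \<Sum>t\<in>T. f n * g m * h t)"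
    for f g h :: "int \<Rightarrow> complex"
    by (simp only: sum_distrib_left[symmetric] sum_distrib_right[symmetric] mult.assoc)
  let ?w = "\<lambda>n m t j. c n * d m * a t * cis (2 * pi * of_int (n + m - t) * ?x j)"
  have "(\<Sum>j<Q. trig_sum D c (?x j) * trig_sum E d (?x j) * trig_sum T a (- ?x j))
      = (\<Sum>j<Q. \<Sum>n\<in>D. \<Sum>m\<in>E. \<Sum>t\<in>T. ?w n m t j)"
  proof (intro sum.cong refl)
    fix j
    have "trig_sum D c (?x j) * trig_sum E d (?x j) * trig_sum T a (- ?x j)
      = (\<Sum>n\<in>D. \<Sum>m\<in>E. \<Sum>t\<in>T. c n * cis (2 * pi * of_int n * ?x j) *
           (d m * cis (2 * pi * of_int m * ?x j)) * (a t * cis (2 * pi * of_int t * - ?x j)))"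
      unfolding trig_sum_def by (rule triple)
    also have "\<dots> = (\<Sum>n\<in>D. \<Sum>m\<in>E. \<Sum>t\<in>T. ?w n m t j)"
    proof (intro sum.cong refl)
      fix n m t
      have "cis (2 * pi * of_int (n + m - t) * ?x j) =
          cis (2 * pi * of_int n * ?x j) * cis (2 * pi * of_int m * ?x j) *
            cis (2 * pi * of_int t * - ?x j)"
        by (simp add: cis_mult algebra_simps)
      then show "c n * cis (2 * pi * of_int n * ?x j) * (d m * cis (2 * pi * of_int m * ?x j)) *
          (a t * cis (2 * pi * of_int t * - ?x j)) = ?w n m t j"
        by (simp add: mult_ac)
    qed
    finally show "trig_sum D c (?x j) * trig_sum E d (?x j) * trig_sum T a (- ?x j)
        = (\<Sum>n\<in>D. \<Sum>m\<in>E. \<Sum>t\<in>T. ?w n m t j)" .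
  qed
  also have "\<dots> = (\<Sum>n\<in>D. \<Sum>j<Q. \<Sum>m\<in>E. \<Sum>t\<in>T. ?w n m t j)" by (rule sum.swap)
  also have "\<dots> = (\<Sum>n\<in>D. \<Sum>m\<in>E. \<Sum>j<Q. \<Sum>t\<in>T. ?w n m t j)" by (intro sum.cong refl sum.swap)
  also have "\<dots> = (\<Sum>n\<in>D. \<Sum>m\<in>E. \<Sum>t\<in>T. \<Sum>j<Q. ?w n m t j)" by (intro sum.cong refl sum.swap)
  also have "\<dots> = (\<Sum>n\<in>D. \<Sum>m\<in>E. \<Sum>t\<in>T. c n * d m * a t * (if n + m - t = 0 then of_nat Q else 0))"
    unfolding sum_distrib_left[symmetric]
    by (intro sum.cong refl arg_cong2[where f = "(*)"] sum_cis_roots Q)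
  also have "\<dots> = (\<Sum>n\<in>D. \<Sum>m\<in>E. c n * d m * a (n + m) * of_nat Q)"
  proof (intro sum.cong refl)
    fix n m assume "n \<in> D" "m \<in> E"
    then show "(\<Sum>t\<in>T. c n * d m * a t * (if n + m - t = 0 then of_nat Q else 0))
        = c n * d m * a (n + m) * of_nat Q"
      using fin(3) T[of n m] by (simp add: if_distrib[of "\<lambda>u. _ * u"] cong: if_cong)
  qed
  finally show ?thesis by (simp add: sum_distrib_left mult_ac)
qed

text \<open>
  The easy half of Nehari's theorem. The Hankel form of \<open>a\<close> is the mean value of
  \<open>trig_sum D c x * trig_sum E d x * trig_sum T a (- x)\<close>; the last factor is at most \<open>C\<close>, and
  Cauchy-Schwarz with Parseval bounds the mean value of the other two.
\<close>
lemma bilinear_bound_trig_sum: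
  assumes fin: "finite D" "finite E" "finite T"
    and T: "\<And>n m. n \<in> D \<Longrightarrow> m \<in> E \<Longrightarrow> n + m \<in> T"
    and bd: "\<And>x. norm (trig_sum T a x) \<le> C"
  shows "bilinear_bound D E (\<lambda>n m. a (n + m)) C"
proof (rule bilinear_boundI)
  fix c d :: "int \<Rightarrow> complex"
  let ?L1 = "L2_set (\<lambda>n. norm (c n)) D" and ?L2 = "L2_set (\<lambda>m. norm (d m)) E"
  obtain L :: int where L: "\<And>n. n \<in> D \<union> E \<union> T \<Longrightarrow> \<bar>n\<bar> \<le> L"
  proof -
    assume *: "\<And>L. (\<And>n. n \<in> D \<union> E \<union> T \<Longrightarrow> \<bar>n\<bar> \<le> L) \<Longrightarrow> thesis"
    have "\<bar>n\<bar> \<le> (\<Sum>n\<in>D \<union> E \<union> T. \<bar>n\<bar>)" if "n \<in> D \<union> E \<union> T" for n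
      using fin that by (intro member_le_sum) auto
    then show thesis using * by blast
  qed
  \<comment> \<open>Differences \<open>n + m - t\<close> are at most \<open>3 * \<bar>L\<bar>\<close>, so no two frequencies are confused modulo \<open>Q\<close>.\<close>
  define Q where "Q = nat (3 * \<bar>L\<bar> + 1)"
  have Q: "Q > 0" "int Q = 3 * \<bar>L\<bar> + 1" by (auto simp: Q_def)
  let ?x = "\<lambda>j. real j / real Q"
  have C: "C \<ge> 0" using bd[of 0] norm_ge_zero order_trans by blast
  have "real Q * norm (\<Sum>n\<in>D. \<Sum>m\<in>E. c n * d m * a (n + m))
      = norm (\<Sum>j<Q. trig_sum D c (?x j) * trig_sum E d (?x j) * trig_sum T a (- ?x j))"
  proof (subst trig_sum_triple_average[OF fin _ T])
    fix n m t assume "n \<in> D" "m \<in> E" "t \<in> T"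
    then show "\<bar>n + m - t\<bar> < int Q" using L[of n] L[of m] L[of t] Q by auto
  qed (auto simp: norm_mult)
  also have "\<dots> \<le> (\<Sum>j<Q. \<bar>norm (trig_sum D c (?x j))\<bar> * \<bar>norm (trig_sum E d (?x j))\<bar> * C)"
    by (rule order.trans[OF norm_sum], intro sum_mono) (auto simp: norm_mult intro!: mult_left_mono bd)
  also have "\<dots> = C * (\<Sum>j<Q. \<bar>norm (trig_sum D c (?x j))\<bar> * \<bar>norm (trig_sum E d (?x j))\<bar>)"
    by (simp add: sum_distrib_left mult_ac)
  also have "\<dots> \<le> C * (L2_set (\<lambda>j. norm (trig_sum D c (?x j))) {..<Q} *
                     L2_set (\<lambda>j. norm (trig_sum E d (?x j))) {..<Q})"
    by (intro mult_left_mono L2_set_mult_ineq C)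
  also have "\<dots> = C * ((sqrt (real Q) * ?L1) * (sqrt (real Q) * ?L2))"
  proof (subst (1 2) trig_sum_parseval)
    show "\<bar>n - n'\<bar> < int Q" if "n \<in> D" "n' \<in> D" for n n'
      using L[of n] L[of n'] Q that by auto
    show "\<bar>n - n'\<bar> < int Q" if "n \<in> E" "n' \<in> E" for n n'
      using L[of n] L[of n'] Q that by auto
  qed (use fin in auto)
  also have "\<dots> = real Q * (C * ?L1 * ?L2)"
    by (simp add: mult_ac)
  finally show "norm (\<Sum>n\<in>D. \<Sum>m\<in>E. c n * d m * a (n + m)) \<le> C * ?L1 * ?L2"
    using Q by simp
qed

text \<open>
  A convergent sum over \<open>\<int>\<close> is absolutely convergent, so cutting the series off at a large finite
  set changes its values by at most \<open>\<eta>\<close> uniformly in \<open>x\<close>, and the case of a finite sum applies.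
\<close>
lemma bilinear_bound_fourier_series:
  assumes fin: "finite D" "finite E"
    and F: "\<And>x. ((\<lambda>n. a n * cis (2 * pi * of_int n * x)) has_sum F x) UNIV"
    and C: "\<And>x. norm (F x) \<le> C"
  shows "bilinear_bound D E (\<lambda>n m. a (n + m)) C"
proof -
  have "a summable_on UNIV"
    using has_sum_imp_summable[OF F[of 0]] by simp
  then have abs: "(\<lambda>n. norm (a n)) summable_on UNIV"
    by (rule summable_on_iff_abs_summable_on_complex[THEN iffD1])
  have close: "bilinear_bound D E (\<lambda>n m. a (n + m)) (C + \<eta>)" if \<eta>: "\<eta> > 0" for \<eta>
  proof -
    obtain T0 where T0: "finite T0" "dist (\<Sum>n\<in>T0. norm (a n)) (\<Sum>\<^sub>\<infinity>n. norm (a n)) \<le> \<eta>"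
      using has_sum_finite_approximation[OF has_sum_infsum[OF abs] \<eta>] by blast
    define T where "T = T0 \<union> (\<lambda>(n, m). n + m) ` (D \<times> E)"
    have T: "finite T" "T0 \<subseteq> T" using T0 fin by (auto simp: T_def)
    have rest: "(\<lambda>n. norm (a n)) summable_on (UNIV - T)"
      using abs by (rule summable_on_subset_banach) auto
    have "(\<Sum>\<^sub>\<infinity>n. norm (a n)) = (\<Sum>n\<in>T. norm (a n)) + (\<Sum>\<^sub>\<infinity>n\<in>UNIV - T. norm (a n))"
      using infsum_Un_disjoint[of "\<lambda>n. norm (a n)" T "UNIV - T"] T rest by simp
    moreover have "(\<Sum>n\<in>T0. norm (a n)) \<le> (\<Sum>n\<in>T. norm (a n))"
      by (intro sum_mono2 T) auto
    ultimately have tail: "(\<Sum>\<^sub>\<infinity>n\<in>UNIV - T. norm (a n)) \<le> \<eta>"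
      using T0(2) unfolding dist_real_def by linarith
    have "norm (trig_sum T a x) \<le> C + \<eta>" for x
    proof -
      have sm: "(\<lambda>n. a n * cis (2 * pi * of_int n * x)) summable_on (UNIV - T)"
        by (rule summable_on_subset_banach[OF has_sum_imp_summable[OF F[of x]]]) auto
      have "F x = trig_sum T a x + (\<Sum>\<^sub>\<infinity>n\<in>UNIV - T. a n * cis (2 * pi * of_int n * x))"
        using infsum_Un_disjoint[of "\<lambda>n. a n * cis (2 * pi * of_int n * x)" T "UNIV - T"] T sm
          infsumI[OF F[of x]] by (simp add: trig_sum_def)
      moreover have "norm (\<Sum>\<^sub>\<infinity>n\<in>UNIV - T. a n * cis (2 * pi * of_int n * x)) \<le> \<eta>"
        using norm_infsum_bound[of "\<lambda>n. a n * cis (2 * pi * of_int n * x)" "UNIV - T"] rest tail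
        by (simp add: norm_mult)
      ultimately show ?thesis
        using C[of x] norm_triangle_ineq4[of "F x" "\<Sum>\<^sub>\<infinity>n\<in>UNIV - T. a n * cis (2 * pi * of_int n * x)"]
        by (simp add: algebra_simps)
    qed
    then show ?thesis
      by (intro bilinear_bound_trig_sum[of D E T]) (use fin T in \<open>auto simp: T_def\<close>)
  qed
  have "(\<lambda>k. C + inverse (real (Suc k))) \<longlonglongrightarrow> C + 0"
    by (intro tendsto_intros LIMSEQ_inverse_real_of_nat)
  then show ?thesis
    using bilinear_bound_limit[of D E "\<lambda>n m. a (n + m)" "\<lambda>k. C + inverse (real (Suc k))"] close
    by simp
qed

section \<open>Bounds on the upper half-plane from modular invariance\<close>

text \<open>
  Every orbit of the modular group reaches the half-plane \<open>Im z \<ge> 1 / 2\<close>: after a translation to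
  \<open>\<bar>Re z\<bar> \<le> 1 / 2\<close>, a point with \<open>Im z < 1 / 2\<close> has \<open>(norm z)\<^sup>2 \<le> 1 / 2\<close>, so the inversion at
  least doubles its height. The height \<open>1 / 2\<close>, rather than the optimal \<open>sqrt 3 / 2\<close>, is what
  makes the number of steps evident.
\<close>
lemma bound_from_translation_inversion:
  fixes H :: "complex \<Rightarrow> real"
  assumes T: "\<And>z b. z \<in> uhp \<Longrightarrow> H (z + of_int b) = H z"
    and S: "\<And>z. z \<in> uhp \<Longrightarrow> H (- 1 / z) = H z"
    and C: "\<And>z. Im z \<ge> 1 / 2 \<Longrightarrow> H z \<le> C"
    and z: "z \<in> uhp"
  shows "H z \<le> C"
proof -
  have step: "H z \<le> C" if "Im z \<ge> (1 / 2) ^ Suc n" for n z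
    using that
  proof (induction n arbitrary: z)
    case 0
    then show ?case using C by simp
  next
    case (Suc n)
    show ?case
    proof (cases "Im z \<ge> 1 / 2")
      case False
      have "0 < (1 / 2 :: real) ^ Suc (Suc n)" by simp
      from less_le_trans[OF this Suc.prems] have z: "z \<in> uhp" by (simp add: uhp_def)
      define w where "w = z + of_int (- round (Re z))"
      have w: "w \<in> uhp" "Im w = Im z" using z by (auto simp: w_def uhp_def)
      have "\<bar>Re w\<bar> \<le> 1 / 2"
        using of_int_round_abs_le[of "Re z"] by (simp add: w_def abs_minus_commute)
      then have "(Re w)\<^sup>2 \<le> (1 / 2)\<^sup>2" by (subst abs_le_square_iff[symmetric]) simp
      moreover have "(Im w)\<^sup>2 \<le> (1 / 2)\<^sup>2"
        using False w z by (intro power_mono) (auto simp: uhp_def)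
      ultimately have "(Re w)\<^sup>2 + (Im w)\<^sup>2 \<le> 1 / 2" by (simp add: power2_eq_square)
      then have "2 * Im w * ((Re w)\<^sup>2 + (Im w)\<^sup>2) \<le> 2 * Im w * (1 / 2)"
        using w by (intro mult_left_mono) (auto simp: uhp_def)
      moreover have "0 < (Re w)\<^sup>2 + (Im w)\<^sup>2"
        using w z by (intro add_nonneg_pos) (auto simp: uhp_def)
      ultimately have "2 * Im w \<le> Im w / ((Re w)\<^sup>2 + (Im w)\<^sup>2)"
        by (simp add: pos_le_divide_eq)
      also have "\<dots> = Im (- 1 / w)"
        by (simp add: Im_divide)
      finally have "2 * Im w \<le> Im (- 1 / w)" .
      then have "Im (- 1 / w) \<ge> (1 / 2) ^ Suc n" using Suc.prems w by simp
      then have "H (- 1 / w) \<le> C" by (rule Suc.IH)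
      also have "H (- 1 / w) = H z" using S[OF w(1)] T[OF z] unfolding w_def by metis
      finally show ?thesis .
    qed (rule C)
  qed
  have "(\<lambda>n. (1 / 2 :: real) ^ Suc n) \<longlonglongrightarrow> 0"
    by (intro LIMSEQ_Suc LIMSEQ_realpow_zero) auto
  then have "\<forall>\<^sub>F n in sequentially. (1 / 2) ^ Suc n < Im z"
    by (rule order_tendstoD(2)) (use z in \<open>simp add: uhp_def\<close>)
  then obtain n where "(1 / 2) ^ Suc n < Im z"
    using eventually_happens' sequentially_bot by blast
  then show ?thesis using step[of n z] by simp
qed

text \<open>
  The function is invariant because \<open>Im (- 1 / z) = Im z / (norm z)\<^sup>2\<close>, which compensates the factor
  \<open>z powi \<kappa>\<close> of modularity.
\<close>
lemma modular_invariant_bound: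
  assumes f: "modular_of_weight \<kappa> f"
    and C: "\<And>z. Im z \<ge> 1 / 2 \<Longrightarrow> Im z powr (of_int \<kappa> / 2) * norm (f z) \<le> C"
    and z: "z \<in> uhp"
  shows "Im z powr (of_int \<kappa> / 2) * norm (f z) \<le> C"
proof (rule bound_from_translation_inversion[of "\<lambda>z. Im z powr (of_int \<kappa> / 2) * norm (f z)", OF _ _ C z])
  have f': "f ((of_int a * z + of_int b) / (of_int c * z + of_int d))
                 = (of_int c * z + of_int d) powi \<kappa> * f z"
    if "a * d - b * c = 1" "z \<in> uhp" for a b c d :: int and z
    using f that unfolding modular_of_weight_def by blast
  show "Im (z + of_int b) powr (of_int \<kappa> / 2) * norm (f (z + of_int b))
      = Im z powr (of_int \<kappa> / 2) * norm (f z)" if "z \<in> uhp" for z b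
    using f'[of 1 1 b 0, OF _ that] by simp
  show "Im (- 1 / z) powr (of_int \<kappa> / 2) * norm (f (- 1 / z))
      = Im z powr (of_int \<kappa> / 2) * norm (f z)" if "z \<in> uhp" for z
  proof -
    have nz: "norm z > 0" using that by (auto simp: uhp_def)
    have "Im (- 1 / z) = Im z / (norm z)\<^sup>2"
      by (simp add: Im_divide cmod_power2)
    moreover have "((norm z)\<^sup>2) powr (of_int \<kappa> / 2) = norm z powi \<kappa>"
      using nz by (simp add: powr_powr powr_real_of_int' flip: powr_numeral)
    ultimately have "Im (- 1 / z) powr (of_int \<kappa> / 2) = Im z powr (of_int \<kappa> / 2) / norm z powi \<kappa>"
      using that by (simp add: powr_divide uhp_def)
    moreover have "f (- 1 / z) = z powi \<kappa> * f z"
      using f'[of 0 0 "-1" 1, OF _ that] by simp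
    ultimately show ?thesis
      using nz by (simp add: norm_mult norm_power_int)
  qed
qed

section \<open>Power weights on Hankel forms\<close>

text \<open>
  Writes a negative power of \<open>u\<close> as an average of the exponentials \<open>exp (- u * t)\<close>.
\<close>
lemma Gamma_integral_scaled:
  assumes "s > (0 :: real)" "u > 0"
  shows "((\<lambda>t. t powr (s - 1) * exp (- u * t)) has_integral (Gamma s * u powr (- s))) {0..}"
proof -
  define g where "g t = indicator {0..} t * t powr (s - 1) / exp t" for t :: real
  have g: "g \<in> borel_measurable borel" unfolding g_def by measurable
  have cancel: "ennreal u * P / ennreal u = P" for P
    using assms ennreal_mult_divide_eq[of "ennreal u" P] by (simp add: mult.commute)
  have "ennreal (Gamma s) = (\<integral>\<^sup>+t. ennreal (g t) \<partial>lborel)"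
    using Gamma_conv_nn_integral_real[OF assms(1)] by (simp add: g_def)
  also have "\<dots> = ennreal u * (\<integral>\<^sup>+t. ennreal (g (0 + u * t)) \<partial>lborel)"
    using assms g by (subst nn_integral_real_affine[where c = u and t = 0]) auto
  finally have "ennreal (Gamma s) / ennreal u = (\<integral>\<^sup>+t. ennreal (g (u * t)) \<partial>lborel)"
    by (simp only: cancel add_0_left)
  moreover have "ennreal (Gamma s) / ennreal u = ennreal (Gamma s / u)"
    using assms Gamma_real_pos[of s] by (intro divide_ennreal) auto
  ultimately have "((\<lambda>t. g (u * t)) has_integral (Gamma s / u)) UNIV"
    using assms g Gamma_real_pos[of s]
    by (intro nn_integral_has_integral) (auto simp: g_def)
  then have "((\<lambda>t. u powr (1 - s) * g (u * t)) has_integral (u powr (1 - s) * (Gamma s / u))) UNIV"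
    by (rule has_integral_mult_right)
  also have "u powr (1 - s) * (Gamma s / u) = Gamma s * u powr (- s)"
    using assms by (simp add: powr_diff powr_minus field_simps)
  also have "(\<lambda>t. u powr (1 - s) * g (u * t)) =
      (\<lambda>t. if t \<in> {0..} then t powr (s - 1) * exp (- u * t) else 0)"
  proof
    fix t
    have "u powr (1 - s) * u powr (s - 1) = 1"
      using assms by (simp flip: powr_add)
    then show "u powr (1 - s) * g (u * t) = (if t \<in> {0..} then t powr (s - 1) * exp (- u * t) else 0)"
      using assms
      by (auto simp: g_def indicator_def powr_mult exp_minus field_simps zero_le_mult_iff)
  qed
  finally show ?thesis by (simp only: has_integral_restrict_UNIV)
qed

text \<open>
  By the Gamma integral \<open>(n + m) powr (- s)\<close> is an average of \<open>exp (- n * t) * exp (- m * t)\<close>, a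
  product weight of size at most \<open>exp (- 2 * X * t)\<close>; the average of these sizes is \<open>(2 * X) powr (- s)\<close>.
\<close>
lemma bilinear_bound_neg_powr_weight:
  assumes X: "X > 0" and fin: "finite D" "finite E"
    and D: "\<And>n. n \<in> D \<Longrightarrow> X \<le> of_int n" and E: "\<And>m. m \<in> E \<Longrightarrow> X \<le> of_int m"
    and B: "bilinear_bound D E B \<beta>" "0 \<le> \<beta>" and s: "s > 0"
  shows "bilinear_bound D E (\<lambda>n m. B n m * of_real (of_int (n + m) powr (- s)))
           ((2 * X) powr (- s) * \<beta>)"
proof -
  define K where "K t n m = complex_of_real (t powr (s - 1)) *
      (of_real (exp (- of_int n * t)) * of_real (exp (- of_int m * t)) * B n m)" for t n m
  have K: "((\<lambda>t. K t n m) has_integral (of_real (Gamma s * of_int (n + m) powr (- s)) * B n m)) {0..}"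
    if "n \<in> D" "m \<in> E" for n m
  proof -
    have "of_int (n + m) > (0 :: real)" using D[OF that(1)] E[OF that(2)] X by simp
    from has_integral_mult_left[OF has_integral_of_real[OF Gamma_integral_scaled[OF s this]], of "B n m"]
    show ?thesis
      by (simp add: K_def exp_add[symmetric] algebra_simps of_real_mult[symmetric] del: of_real_mult)
  qed
  have i1: "bilinear_bound D E (\<lambda>n m. integral {0..} (\<lambda>t. K t n m))
          (integral {0..} (\<lambda>t. t powr (s - 1) * exp (- (2 * X) * t) * \<beta>))"
  proof (rule bilinear_bound_integral[OF fin])
    fix t :: real assume t: "t \<in> {0..}"
    have "bilinear_bound D E (\<lambda>n m. of_real (exp (- of_int n * t)) * of_real (exp (- of_int m * t)) * B n m)
        (exp (- X * t) * exp (- X * t) * \<beta>)"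
      by (rule bilinear_bound_weight[OF B]) (use t D E in \<open>auto intro: mult_right_mono\<close>)
    from bilinear_bound_scale[OF this, of "complex_of_real (t powr (s - 1))"]
    show "bilinear_bound D E (K t) (t powr (s - 1) * exp (- (2 * X) * t) * \<beta>)"
      unfolding K_def
      by (rule bilinear_bound_cong) (use B in \<open>auto simp: mult_ac simp flip: exp_add\<close>)
  next
    show "(\<lambda>t. t powr (s - 1) * exp (- (2 * X) * t) * \<beta>) integrable_on {0..}"
      by (rule integrable_on_mult_left[OF has_integral_integrable[OF Gamma_integral_scaled[OF s]]])
         (use X in auto)
  qed (use K in \<open>blast intro: has_integral_integrable\<close>)
  have i2: "integral {0..} (\<lambda>t. t powr (s - 1) * exp (- (2 * X) * t) * \<beta>)
      = Gamma s * (2 * X) powr (- s) * \<beta>"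
    using X by (intro integral_unique has_integral_mult_left Gamma_integral_scaled s) auto
  have "bilinear_bound D E (\<lambda>n m. of_real (Gamma s * of_int (n + m) powr (- s)) * B n m)
      (Gamma s * (2 * X) powr (- s) * \<beta>)"
    by (rule bilinear_bound_cong[OF i1[unfolded i2]]) (auto simp: integral_unique[OF K])
  moreover have G: "Gamma s > 0" using s by (rule Gamma_real_pos)
  ultimately have "bilinear_bound D E (\<lambda>n m. of_real (1 / Gamma s) * (of_real (Gamma s * of_int (n + m) powr (- s)) * B n m))
      (norm (complex_of_real (1 / Gamma s)) * (Gamma s * (2 * X) powr (- s) * \<beta>))"
    using B by (intro bilinear_bound_scale) auto
  then show ?thesis
    by (rule bilinear_bound_cong) (use G in \<open>auto simp: norm_divide mult_ac\<close>)
qed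

lemma finite_dyadic_ints [simp]: "finite (dyadic_ints X)"
proof -
  have "dyadic_ints X \<subseteq> {\<lfloor>X\<rfloor>..\<lceil>2 * X\<rceil>}"
    by (auto simp: dyadic_ints_def; linarith)
  then show ?thesis by (rule finite_subset) simp
qed

text \<open>
  Nonnegative exponents reduce to negative ones, since the weight \<open>n + m\<close> is a sum of two product
  weights of size at most \<open>2 * X\<close>.
\<close>
lemma bilinear_bound_powr_weight:
  "\<exists>K\<ge>0. \<forall>X>0. \<forall>B \<beta>. 0 \<le> \<beta> \<longrightarrow> bilinear_bound (dyadic_ints X) (dyadic_ints X) B \<beta> \<longrightarrow>
     bilinear_bound (dyadic_ints X) (dyadic_ints X)
       (\<lambda>n m. B n m * of_real (of_int (n + m) powr r)) (K * X powr r * \<beta>)"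
proof -
  have "\<exists>K\<ge>0. \<forall>X>0. \<forall>B \<beta>. 0 \<le> \<beta> \<longrightarrow> bilinear_bound (dyadic_ints X) (dyadic_ints X) B \<beta> \<longrightarrow>
     bilinear_bound (dyadic_ints X) (dyadic_ints X)
       (\<lambda>n m. B n m * of_real (of_int (n + m) powr r)) (K * X powr r * \<beta>)"
    if "r < real j" for j r
    using that
  proof (induction j arbitrary: r)
    case 0
    show ?case
    proof (intro exI[of _ "2 powr r"] conjI allI impI)
      fix X \<beta> :: real and B
      assume *: "X > 0" "0 \<le> \<beta>" "bilinear_bound (dyadic_ints X) (dyadic_ints X) B \<beta>"
      have "bilinear_bound (dyadic_ints X) (dyadic_ints X)
        (\<lambda>n m. B n m * of_real (of_int (n + m) powr (- (- r)))) ((2 * X) powr (- (- r)) * \<beta>)"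
        by (rule bilinear_bound_neg_powr_weight[OF *(1) finite_dyadic_ints finite_dyadic_ints _ _ *(3,2)])
           (use 0 in \<open>auto simp: dyadic_ints_def\<close>)
      then show "bilinear_bound (dyadic_ints X) (dyadic_ints X)
        (\<lambda>n m. B n m * of_real (of_int (n + m) powr r)) (2 powr r * X powr r * \<beta>)"
        using * by (simp add: powr_mult)
    qed auto
  next
    case (Suc j)
    then have "r - 1 < real j" by simp
    from Suc.IH[OF this] obtain K where K: "K \<ge> 0"
      "\<And>X B \<beta>. X > 0 \<Longrightarrow> 0 \<le> \<beta> \<Longrightarrow> bilinear_bound (dyadic_ints X) (dyadic_ints X) B \<beta> \<Longrightarrow>
       bilinear_bound (dyadic_ints X) (dyadic_ints X)
       (\<lambda>n m. B n m * of_real (of_int (n + m) powr (r - 1))) (K * X powr (r - 1) * \<beta>)"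
      by blast
    show ?case
    proof (intro exI[of _ "4 * K"] conjI allI impI)
      fix X \<beta> :: real and B
      assume X: "X > 0" and \<beta>: "0 \<le> \<beta>" and B: "bilinear_bound (dyadic_ints X) (dyadic_ints X) B \<beta>"
      let ?D = "dyadic_ints X"
      define W where "W n m = B n m * of_real (of_int (n + m) powr (r - 1))" for n m
      have W: "bilinear_bound ?D ?D W (K * X powr (r - 1) * \<beta>)" and nn: "0 \<le> K * X powr (r - 1) * \<beta>"
        using K(2)[OF X \<beta> B] K(1) \<beta> by (auto simp: W_def[abs_def])
      have "bilinear_bound ?D ?D (\<lambda>n m. of_int n * 1 * W n m) (2 * X * 1 * (K * X powr (r - 1) * \<beta>))"
        by (rule bilinear_bound_weight[OF W nn]) (use X in \<open>auto simp: dyadic_ints_def\<close>)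
      moreover have "bilinear_bound ?D ?D (\<lambda>n m. 1 * of_int m * W n m) (1 * (2 * X) * (K * X powr (r - 1) * \<beta>))"
        by (rule bilinear_bound_weight[OF W nn]) (use X in \<open>auto simp: dyadic_ints_def\<close>)
      ultimately have "bilinear_bound ?D ?D (\<lambda>n m. of_int n * 1 * W n m + 1 * of_int m * W n m)
          (2 * X * 1 * (K * X powr (r - 1) * \<beta>) + 1 * (2 * X) * (K * X powr (r - 1) * \<beta>))"
        by (rule bilinear_bound_add)
      then show "bilinear_bound ?D ?D (\<lambda>n m. B n m * of_real (of_int (n + m) powr r)) (4 * K * X powr r * \<beta>)"
      proof (rule bilinear_bound_cong)
        fix n m assume "n \<in> ?D" "m \<in> ?D"
        then have pos: "of_int (n + m) > (0 :: real)" using X by (auto simp: dyadic_ints_def)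
        then have "of_int (n + m) powr r = of_int (n + m) * of_int (n + m) powr (r - 1)"
          by (simp add: powr_diff)
        then show "of_int n * 1 * W n m + 1 * of_int m * W n m = B n m * of_real (of_int (n + m) powr r)"
          by (simp add: W_def algebra_simps)
      next
        have "X powr r = X * X powr (r - 1)" using X by (simp add: powr_diff)
        then show "2 * X * 1 * (K * X powr (r - 1) * \<beta>) + 1 * (2 * X) * (K * X powr (r - 1) * \<beta>)
            = 4 * K * X powr r * \<beta>" by (simp add: algebra_simps)
      qed
    qed (use K in auto)
  qed
  then show ?thesis using reals_Archimedean2[of r] by blast
qed

text \<open>
  Bounded below by \<open>1 / 2\<close>, \<open>y\<close> may carry an exponent of either sign; the lemma lets the
  decay at the cusp absorb the factor \<open>Im z powr (\<kappa> / 2)\<close>.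
\<close>
lemma powr_le_exp_growth:
  fixes p :: real
  shows "\<exists>K\<ge>0. \<forall>y\<ge>1 / 2. y powr p \<le> K * exp y"
proof (intro exI[of _ "exp (\<bar>p\<bar> * (ln (\<bar>p\<bar> + 1) + ln 2))"] conjI allI impI)
  fix y :: real assume y: "y \<ge> 1 / 2"
  define q where "q = \<bar>p\<bar> + 1"
  have q: "q \<ge> 1" "\<bar>p\<bar> \<le> q" by (auto simp: q_def)
  have "ln y = ln (y / q) + ln q" using y q by (simp add: ln_div)
  also have "ln (y / q) \<le> y / q - 1" using y q by (intro ln_le_minus_one) auto
  finally have "ln y \<le> y / q + ln q" by simp
  moreover have "- ln y \<le> ln 2"
    using ln_mono[of "1/2" y] y by (simp add: ln_div)
  moreover have "0 \<le> ln q" "0 \<le> ln (2 :: real)" "0 \<le> y / q" using q y by auto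
  ultimately have "\<bar>ln y\<bar> \<le> y / q + (ln q + ln 2)" by linarith
  then have "\<bar>p\<bar> * \<bar>ln y\<bar> \<le> \<bar>p\<bar> * (y / q + (ln q + ln 2))" by (rule mult_left_mono) auto
  also have "\<bar>p\<bar> * (y / q) \<le> q * (y / q)" using q y by (intro mult_right_mono) auto
  then have "\<bar>p\<bar> * (y / q + (ln q + ln 2)) \<le> y + \<bar>p\<bar> * (ln q + ln 2)"
    using q by (simp add: algebra_simps)
  finally have "p * ln y \<le> y + \<bar>p\<bar> * (ln q + ln 2)"
    using abs_ge_self[of "p * ln y"] by (simp add: abs_mult)
  then show "y powr p \<le> exp (\<bar>p\<bar> * (ln (\<bar>p\<bar> + 1) + ln 2)) * exp y"
    using y by (simp add: powr_def q_def flip: exp_add)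
qed auto

section \<open>Coefficients of holomorphic forms\<close>

text \<open>
  On the line \<open>Im z = 1 / X\<close> invariance gives \<open>norm (f z) \<le> C * X powr (\<kappa> / 2)\<close>, which bounds the Hankel
  form of the coefficients \<open>A n * n powr s * exp (- 2 * pi * n / X)\<close> with \<open>s = (\<kappa> - 1) / 2\<close>. The
  exponential is a product weight of bounded size on \<open>[X, 2 X]\<close>, and removing the power gains
  \<open>X powr (- s)\<close>, which leaves \<open>sqrt X\<close>.
\<close>
lemma holomorphic_hankel_bound:
  assumes mod: "modular_of_weight \<kappa> f" and A: "holomorphic_fourier_coeffs \<kappa> f A"
  shows "\<exists>C\<ge>0. \<forall>X\<ge>1. bilinear_bound (dyadic_ints X) (dyadic_ints X) (\<lambda>n m. A (n + m)) (C * sqrt X)"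
proof -
  define s where "s = (real_of_int \<kappa> - 1) / 2"
  define a where "a y n = (if n \<ge> 1 then A n * of_real (of_int n powr s) * of_real (exp (- (2 * pi * of_int n * y))) else 0)"
    for y :: real and n :: int
  have e: "e_char (of_int n * Complex x y) = of_real (exp (- (2 * pi * of_int n * y))) * cis (2 * pi * of_int n * x)"
    for n x y
    by (simp add: e_char_def complex_eq_iff Re_exp Im_exp algebra_simps)
  have series: "((\<lambda>n. a y n * cis (2 * pi * of_int n * x)) has_sum f (Complex x y)) UNIV" if "y > 0" for x y
  proof -
    have "((\<lambda>n. a y n * cis (2 * pi * of_int n * x)) has_sum f (Complex x y)) {n. n \<ge> 1}"
    proof (rule has_sum_cong[THEN iffD1])
      show "((\<lambda>n. A n * of_real (of_int n powr ((of_int \<kappa> - 1) / 2)) * e_char (of_int n * Complex x y))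
              has_sum f (Complex x y)) {n. n \<ge> 1}"
        using A that unfolding holomorphic_fourier_coeffs_def by (simp add: uhp_def)
    qed (simp add: e a_def s_def)
    then show ?thesis
      by (rule has_sum_cong_neutral[THEN iffD1, rotated -1]) (auto simp: a_def)
  qed
  have "a (1 / 4) summable_on UNIV"
    using has_sum_imp_summable[OF series[of "1/4" 0]] by simp
  then have abs: "(\<lambda>n. norm (a (1 / 4) n)) summable_on UNIV"
    by (rule summable_on_iff_abs_summable_on_complex[THEN iffD1])
  define G where "G = (\<Sum>\<^sub>\<infinity>n. norm (a (1 / 4) n))"
  have G: "G \<ge> 0" unfolding G_def by (intro infsum_nonneg) auto
  \<comment> \<open>Convergence at height \<open>1 / 4\<close> controls all greater heights, as every frequency is at least 1.\<close>
  have decay: "norm (f (Complex x y)) \<le> G * exp (- (2 * pi * (y - 1 / 4)))" if y: "y \<ge> 1 / 2" for x y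
  proof -
    let ?q = "exp (- (2 * pi * (y - 1 / 4)))"
    have "((\<lambda>n. norm (a (1 / 4) n) * ?q) has_sum G * ?q) UNIV"
      unfolding G_def by (intro has_sum_cmult_left has_sum_infsum abs)
    moreover have "norm (a y n * cis (2 * pi * of_int n * x)) \<le> norm (a (1 / 4) n) * ?q" for n
    proof (cases "n \<ge> 1")
      case True
      have "1 * (y - 1 / 4) \<le> of_int n * (y - 1 / 4)"
        using y True by (intro mult_right_mono) auto
      then have "2 * pi * (y - 1 / 4) \<le> 2 * pi * (of_int n * (y - 1 / 4))"
        by (intro mult_left_mono) auto
      then have "exp (- (2 * pi * of_int n * y)) \<le> exp (- (2 * pi * of_int n * (1 / 4))) * ?q"
        unfolding exp_add[symmetric] exp_le_cancel_iff by (simp add: algebra_simps)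
      from mult_left_mono[OF this, of "norm (A n) * of_int n powr s"] show ?thesis
        using True by (simp add: a_def norm_mult mult.assoc)
    qed (simp add: a_def)
    moreover have "((\<lambda>n. a y n * cis (2 * pi * of_int n * x)) has_sum f (Complex x y)) UNIV"
      using y by (intro series) auto
    ultimately show ?thesis
      by (rule norm_infsum_le[rotated])
  qed
  obtain K :: real where K: "K \<ge> 0" "\<And>y. y \<ge> 1 / 2 \<Longrightarrow> y powr (of_int \<kappa> / 2) \<le> K * exp y"
    using powr_le_exp_growth[of "of_int \<kappa> / 2"] by blast
  have cusp: "Im z powr (of_int \<kappa> / 2) * norm (f z) \<le> K * G * exp (pi / 2)" if z: "Im z \<ge> 1 / 2" for z
  proof -
    have "Im z powr (of_int \<kappa> / 2) * norm (f z)
        \<le> (K * exp (Im z)) * (G * exp (- (2 * pi * (Im z - 1 / 4))))"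
      using z K decay[of "Im z" "Re z"] by (intro mult_mono) auto
    also have "\<dots> = K * G * exp (Im z - 2 * pi * (Im z - 1 / 4))"
      using exp_add[of "Im z" "- (2 * pi * (Im z - 1 / 4))"] by (simp add: mult_ac)
    also have "\<dots> \<le> K * G * exp (pi / 2)"
    proof (intro mult_left_mono)
      have "1 * Im z \<le> 2 * pi * Im z" using z pi_gt3 by (intro mult_right_mono) auto
      then show "exp (Im z - 2 * pi * (Im z - 1 / 4)) \<le> exp (pi / 2)" by (simp add: algebra_simps)
    qed (use K G in auto)
    finally show ?thesis .
  qed
  define C where "C = K * G * exp (pi / 2)"
  have C: "C \<ge> 0" "\<And>z. z \<in> uhp \<Longrightarrow> Im z powr (of_int \<kappa> / 2) * norm (f z) \<le> C"
    using modular_invariant_bound[OF mod cusp] K(1) G by (auto simp: C_def)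
  obtain K' where K': "K' \<ge> 0" "\<And>X B \<beta>. X > 0 \<Longrightarrow> 0 \<le> \<beta> \<Longrightarrow>
     bilinear_bound (dyadic_ints X) (dyadic_ints X) B \<beta> \<Longrightarrow>
     bilinear_bound (dyadic_ints X) (dyadic_ints X)
       (\<lambda>n m. B n m * of_real (of_int (n + m) powr (- s))) (K' * X powr (- s) * \<beta>)"
    using bilinear_bound_powr_weight[of "- s"] by blast
  show ?thesis
  proof (intro exI[of _ "K' * (exp (4 * pi) * exp (4 * pi) * C)"] conjI allI impI)
    fix X :: real assume X: "X \<ge> 1"
    let ?D = "dyadic_ints X"
    let ?w = "\<lambda>n. complex_of_real (exp (2 * pi * of_int n / X))"
    have bd: "norm (f (Complex x (1 / X))) \<le> C * X powr (of_int \<kappa> / 2)" for x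
      using C(2)[of "Complex x (1 / X)"] X by (simp add: uhp_def powr_divide field_simps)
    have "bilinear_bound ?D ?D (\<lambda>n m. a (1 / X) (n + m)) (C * X powr (of_int \<kappa> / 2))"
      by (rule bilinear_bound_fourier_series[OF _ _ series bd]) (use X in auto)
    then have "bilinear_bound ?D ?D (\<lambda>n m. ?w n * ?w m * a (1 / X) (n + m))
        (exp (4 * pi) * exp (4 * pi) * (C * X powr (of_int \<kappa> / 2)))"
      by (rule bilinear_bound_weight) (use X C in \<open>auto simp: dyadic_ints_def field_simps\<close>)
    from K'(2)[OF _ _ this] have "bilinear_bound ?D ?D
       (\<lambda>n m. ?w n * ?w m * a (1 / X) (n + m) * of_real (of_int (n + m) powr (- s)))
       (K' * X powr (- s) * (exp (4 * pi) * exp (4 * pi) * (C * X powr (of_int \<kappa> / 2))))"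
      using X C by simp
    then show "bilinear_bound ?D ?D (\<lambda>n m. A (n + m)) (K' * (exp (4 * pi) * exp (4 * pi) * C) * sqrt X)"
    proof (rule bilinear_bound_cong)
      fix n m assume "n \<in> ?D" "m \<in> ?D"
      then have pos: "n + m \<ge> 1" using X by (auto simp: dyadic_ints_def)
      have "exp (2 * pi * of_int n / X) * exp (2 * pi * of_int m / X) *
          exp (- (2 * pi * of_int (n + m) * (1 / X))) = 1"
        unfolding exp_add[symmetric] exp_eq_one_iff by (simp add: algebra_simps add_divide_distrib)
      moreover have "of_int (n + m) powr s * of_int (n + m) powr (- s) = (1 :: real)"
        using pos by (simp add: powr_minus)
      ultimately have "complex_of_real ((exp (2 * pi * of_int n / X) * exp (2 * pi * of_int m / X) *
          exp (- (2 * pi * of_int (n + m) * (1 / X)))) * (of_int (n + m) powr s * of_int (n + m) powr (- s))) = 1"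
        by simp
      then have "A (n + m) * complex_of_real ((exp (2 * pi * of_int n / X) * exp (2 * pi * of_int m / X) *
          exp (- (2 * pi * of_int (n + m) * (1 / X)))) * (of_int (n + m) powr s * of_int (n + m) powr (- s))) = A (n + m)"
        by simp
      then show "?w n * ?w m * a (1 / X) (n + m) * of_real (of_int (n + m) powr (- s)) = A (n + m)"
        using pos unfolding a_def of_real_mult by (simp add: mult_ac)
    next
      have "X powr (- s) * X powr (of_int \<kappa> / 2) = sqrt X"
        using X by (simp add: s_def powr_half_sqrt[symmetric] field_simps flip: powr_add)
      then show "K' * X powr (- s) * (exp (4 * pi) * exp (4 * pi) * (C * X powr (of_int \<kappa> / 2)))
          = K' * (exp (4 * pi) * exp (4 * pi) * C) * sqrt X"
        by (simp add: mult_ac) 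
    qed
  qed (use K' C in auto)
qed

section \<open>The Bessel function\<close>

lemma cosh_real_ge_quadratic:
  assumes "0 \<le> (t :: real)"
  shows "t\<^sup>2 / 4 \<le> cosh t"
proof -
  have "1 + t + t\<^sup>2 / 2 \<le> exp t" by (rule exp_lower_Taylor_quadratic[OF assms])
  moreover have "cosh t = exp t / 2 + exp (- t) / 2" by (simp add: cosh_def add_divide_distrib)
  moreover have "0 \<le> exp (- t)" by simp
  ultimately show ?thesis using assms by linarith
qed

text \<open>
  Since \<open>cosh t \<ge> t\<^sup>2 / 4\<close>, completing the square bounds the exponent by a constant minus \<open>t\<close>.
\<close>
lemma integrable_bessel_majorant:
  assumes "0 < y"
  shows "(\<lambda>t. exp (w * t - y * cosh t) :: real) integrable_on {0..}"
proof (rule measurable_bounded_by_integrable_imp_integrable)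
  show "(\<lambda>t. exp ((w + 1)\<^sup>2 / y) * exp (- 1 * t)) integrable_on {0..}"
    by (intro integrable_on_mult_right integrable_on_exp_minus_to_infinity) auto
  show "norm (exp (w * t - y * cosh t)) \<le> exp ((w + 1)\<^sup>2 / y) * exp (- 1 * t)"
    if "t \<in> {0..}" for t
  proof -
    have "y * (t\<^sup>2 / 4) \<le> y * cosh t"
      using assms that by (intro mult_left_mono cosh_real_ge_quadratic) auto
    moreover have "(w + 1)\<^sup>2 / y + y * (t\<^sup>2 / 4) - (w + 1) * t = (y * t / 2 - (w + 1))\<^sup>2 / y"
      using assms by (simp add: power2_eq_square field_simps)
    moreover have "0 \<le> (y * t / 2 - (w + 1))\<^sup>2 / y" using assms by simp
    ultimately have "w * t - y * cosh t \<le> (w + 1)\<^sup>2 / y - t" by (simp add: algebra_simps)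
    then show ?thesis by (simp add: mult_exp_exp)
  qed
  show "(\<lambda>t. exp (w * t - y * cosh t)) \<in> borel_measurable (lebesgue_on {0..})"
    by (intro continuous_imp_measurable_on_sets_lebesgue continuous_intros) auto
qed auto

lemma norm_cosh_le_exp: "norm (cosh (z :: complex)) \<le> exp (norm z)"
proof -
  have "norm (cosh z) = norm (exp z + exp (- z)) / 2"
    by (simp add: cosh_def norm_divide scaleR_conv_of_real norm_mult)
  also have "norm (exp z + exp (- z)) \<le> exp (norm z) + exp (norm (- z))"
    by (intro order.trans[OF norm_triangle_ineq] add_mono norm_exp)
  finally show ?thesis by simp
qed

lemma norm_bessel_integrand_le:
  assumes "0 \<le> t"
  shows "norm (of_real (exp (- y * cosh t)) * cosh (s * of_real t) :: complex)
           \<le> exp (norm s * t - y * cosh t)"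
proof -
  have "norm (cosh (s * of_real t)) \<le> exp (norm s * t)"
    using norm_cosh_le_exp[of "s * complex_of_real t"] assms by (simp add: norm_mult)
  then have "exp (- y * cosh t) * norm (cosh (s * of_real t)) \<le> exp (- y * cosh t) * exp (norm s * t)"
    by (rule mult_left_mono) auto
  then show ?thesis by (simp add: norm_mult mult_exp_exp)
qed

lemma integrable_bessel_integrand:
  assumes "0 < y"
  shows "(\<lambda>t. of_real (exp (- y * cosh t)) * cosh (s * of_real t) :: complex) integrable_on {0..}"
proof (rule measurable_bounded_by_integrable_imp_integrable)
  show "(\<lambda>t. exp (norm s * t - y * cosh t)) integrable_on {0..}"
    by (rule integrable_bessel_majorant[OF assms])
  show "(\<lambda>t. of_real (exp (- y * cosh t)) * cosh (s * of_real t) :: complex)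
      \<in> borel_measurable (lebesgue_on {0..})"
    by (intro continuous_imp_measurable_on_sets_lebesgue continuous_intros) auto
qed (use norm_bessel_integrand_le in auto)

definition bessel_majorant :: "complex \<Rightarrow> real" where
  "bessel_majorant s = integral {0..} (\<lambda>t. exp (norm s * t - cosh t))"

lemma has_integral_bessel_majorant:
  "((\<lambda>t. exp (norm s * t - cosh t)) has_integral bessel_majorant s) {0..}"
  unfolding bessel_majorant_def
  using integrable_bessel_majorant[of 1 "norm s"] by (simp add: integrable_integral)

lemma bessel_majorant_nonneg: "0 \<le> bessel_majorant s"
  by (rule has_integral_nonneg[OF has_integral_bessel_majorant]) auto

lemma norm_bessel_K_le:
  assumes "1 \<le> u"
  shows "norm (bessel_K s u) \<le> exp (1 - u) * bessel_majorant s"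
proof -
  have "norm (bessel_K s u) \<le> integral {0..} (\<lambda>t. exp (1 - u) * exp (norm s * t - cosh t))"
    unfolding bessel_K_def
  proof (rule integral_norm_bound_integral)
    show "(\<lambda>t. of_real (exp (- u * cosh t)) * cosh (s * of_real t) :: complex) integrable_on {0..}"
      using assms by (intro integrable_bessel_integrand) auto
    show "(\<lambda>t. exp (1 - u) * exp (norm s * t - cosh t)) integrable_on {0..}"
      by (intro integrable_on_mult_right has_integral_integrable[OF has_integral_bessel_majorant])
    fix t :: real assume t: "t \<in> {0..}"
    have "(u - 1) * 1 \<le> (u - 1) * cosh t"
      using assms by (intro mult_left_mono cosh_real_ge_1) auto
    then have "exp (norm s * t - u * cosh t) \<le> exp (1 - u) * exp (norm s * t - cosh t)"
      unfolding mult_exp_exp exp_le_cancel_iff by (simp add: algebra_simps)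
    then show "norm (of_real (exp (- u * cosh t)) * cosh (s * of_real t) :: complex)
        \<le> exp (1 - u) * exp (norm s * t - cosh t)"
      using norm_bessel_integrand_le[of t u s] t by simp
  qed
  also have "\<dots> = exp (1 - u) * bessel_majorant s"
    by (intro integral_unique has_integral_mult_right has_integral_bessel_majorant)
  finally show ?thesis .
qed

text \<open>
  The order \<open>s\<close> is an arbitrary complex number, so \<open>cosh (s * t)\<close> may oscillate or be complex; only
  near \<open>t = 0\<close> is it close to 1.
\<close>
lemma cosh_near_zero:
  "\<exists>t\<^sub>0>0. cosh t\<^sub>0 \<le> 3 / 2 \<and> (\<forall>t. 0 \<le> t \<longrightarrow> t \<le> t\<^sub>0 \<longrightarrow> 1 / 2 \<le> Re (cosh (s * complex_of_real t)))"
proof -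
  have "((\<lambda>t::real. Re (cosh (s * complex_of_real t))) \<longlongrightarrow> Re (cosh (s * complex_of_real 0))) (nhds 0)"
    by (intro tendsto_intros) (simp add: filterlim_ident)
  then have "\<forall>\<^sub>F t in nhds (0 :: real). 1 / 2 < Re (cosh (s * complex_of_real t))"
    by (rule order_tendstoD(1)) simp
  moreover have "((\<lambda>t::real. cosh t) \<longlongrightarrow> cosh 0) (nhds 0)"
    by (intro tendsto_intros) (simp add: filterlim_ident)
  then have "\<forall>\<^sub>F t in nhds (0 :: real). cosh t < 3 / 2"
    by (rule order_tendstoD(2)) simp
  ultimately have "\<forall>\<^sub>F t in nhds (0 :: real). 1 / 2 < Re (cosh (s * complex_of_real t)) \<and> cosh t < 3 / 2"
    by (rule eventually_conj)
  then obtain d where d: "d > 0" "\<And>t::real. dist t 0 < d \<Longrightarrow>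
      1 / 2 < Re (cosh (s * complex_of_real t)) \<and> cosh t < 3 / 2"
    unfolding eventually_nhds_metric by blast
  show ?thesis
  proof (intro exI[of _ "d / 2"] conjI allI impI)
    show "cosh (d / 2) \<le> 3 / 2" using d(2)[of "d / 2"] d(1) by simp
    show "1 / 2 \<le> Re (cosh (s * complex_of_real t))" if "0 \<le> t" "t \<le> d / 2" for t
      using d(2)[of t] d(1) that by simp
  qed (use d in simp)
qed

text \<open>
  The part \<open>t \<le> t\<^sub>1\<close> of the integral contributes a positive amount, whereas beyond \<open>t\<^sub>0\<close> the
  integrand, though of unknown sign, carries the smaller exponential \<open>exp (- u * cosh t\<^sub>0)\<close>.
\<close>
lemma Re_bessel_K_ge:
  assumes t: "0 < t\<^sub>1" "t\<^sub>1 < t\<^sub>0" "\<And>t. 0 \<le> t \<Longrightarrow> t \<le> t\<^sub>0 \<Longrightarrow> 1 / 2 \<le> Re (cosh (s * complex_of_real t))"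
    and u: "1 \<le> u"
  shows "t\<^sub>1 / 2 * exp (- u * cosh t\<^sub>1) - exp (- (u - 1) * cosh t\<^sub>0) * bessel_majorant s
           \<le> Re (bessel_K s u)"
proof -
  let ?low = "\<lambda>t. (if t \<in> {0..t\<^sub>1} then exp (- u * cosh t\<^sub>1) / 2 else 0)
                 - exp (- (u - 1) * cosh t\<^sub>0) * exp (norm s * t - cosh t)"
  have "(?low has_integral (t\<^sub>1 / 2 * exp (- u * cosh t\<^sub>1) - exp (- (u - 1) * cosh t\<^sub>0) * bessel_majorant s)) {0..}"
  proof (intro has_integral_diff has_integral_mult_right has_integral_bessel_majorant)
    have "((\<lambda>t. exp (- u * cosh t\<^sub>1) / 2) has_integral (t\<^sub>1 / 2 * exp (- u * cosh t\<^sub>1))) {0..t\<^sub>1}"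
      using has_integral_const_real[of "exp (- u * cosh t\<^sub>1) / 2" 0 t\<^sub>1] t by simp
    then show "((\<lambda>t. if t \<in> {0..t\<^sub>1} then exp (- u * cosh t\<^sub>1) / 2 else 0) has_integral
        (t\<^sub>1 / 2 * exp (- u * cosh t\<^sub>1))) {0..}"
      by (subst has_integral_restrict) auto
  qed
  moreover have "((\<lambda>t. Re (of_real (exp (- u * cosh t)) * cosh (s * of_real t))) has_integral Re (bessel_K s u)) {0..}"
    unfolding bessel_K_def using u
    by (intro has_integral_Re integrable_integral integrable_bessel_integrand) auto
  ultimately show ?thesis
  proof (rule has_integral_le)
    fix t :: real assume "t \<in> {0..}"
    then have t0: "0 \<le> t" by simp
    show "?low t \<le> Re (of_real (exp (- u * cosh t)) * cosh (s * of_real t))"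
    proof (cases "t \<le> t\<^sub>0")
      case True
      have "(if t \<in> {0..t\<^sub>1} then exp (- u * cosh t\<^sub>1) / 2 else 0) \<le> exp (- u * cosh t) * (1 / 2)"
        using t0 t(1) u by (auto simp: cosh_real_nonneg_le_iff)
      also have "\<dots> \<le> exp (- u * cosh t) * Re (cosh (s * of_real t))"
        using t(3)[OF t0 True] by (intro mult_left_mono) auto
      finally have *: "(if t \<in> {0..t\<^sub>1} then exp (- u * cosh t\<^sub>1) / 2 else 0)
          \<le> exp (- u * cosh t) * Re (cosh (s * of_real t))" .
      have "0 \<le> exp (- (u - 1) * cosh t\<^sub>0) * exp (norm s * t - cosh t)" by simp
      moreover have "Re (of_real (exp (- u * cosh t)) * cosh (s * of_real t))
          = exp (- u * cosh t) * Re (cosh (s * of_real t))"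
        by (simp del: of_real_exp)
      ultimately show ?thesis using * by linarith
    next
      case False
      have "(u - 1) * cosh t\<^sub>0 \<le> (u - 1) * cosh t"
        using False u t by (intro mult_left_mono) (auto simp: cosh_real_nonneg_le_iff)
      then have "exp (norm s * t - u * cosh t) \<le> exp (- (u - 1) * cosh t\<^sub>0) * exp (norm s * t - cosh t)"
        unfolding mult_exp_exp exp_le_cancel_iff by (simp add: algebra_simps)
      moreover have "\<bar>Re (of_real (exp (- u * cosh t)) * cosh (s * of_real t))\<bar> \<le> exp (norm s * t - u * cosh t)"
        using order.trans[OF abs_Re_le_cmod norm_bessel_integrand_le[OF t0, of u s]] .
      ultimately show ?thesis using False t by (auto simp del: of_real_exp)
    qed
  qed
qed

text \<open>
  For a large argument the integral is dominated by its start, so \<open>bessel_K\<close> has no large zeros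
  and decays not much faster than \<open>exp (- u)\<close>. Any exponent between 1 and 2 could replace \<open>3 / 2\<close>:
  from 2 on, \<open>maass_bounded_high\<close> would lose the competition between growth and decay.
\<close>
lemma norm_bessel_K_ge:
  "\<exists>U c. 3 \<le> U \<and> 0 < c \<and> (\<forall>u\<ge>U. c * exp (- (3 / 2) * u) \<le> norm (bessel_K s u))"
proof -
  obtain t\<^sub>0 :: real where t0: "t\<^sub>0 > 0" "cosh t\<^sub>0 \<le> 3 / 2"
    "\<And>t. 0 \<le> t \<Longrightarrow> t \<le> t\<^sub>0 \<Longrightarrow> 1 / 2 \<le> Re (cosh (s * complex_of_real t))"
    using cosh_near_zero[of s] by blast
  define t\<^sub>1 where "t\<^sub>1 = t\<^sub>0 / 2"
  have t1: "0 < t\<^sub>1" "t\<^sub>1 < t\<^sub>0" using t0 by (auto simp: t\<^sub>1_def)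
  define d where "d = cosh t\<^sub>0 - cosh t\<^sub>1"
  have d: "d > 0" using t0 t1 by (simp add: d_def cosh_real_nonneg_less_iff)
  define J where "J = exp (cosh t\<^sub>0) * bessel_majorant s"
  have J: "J \<ge> 0" using bessel_majorant_nonneg by (simp add: J_def)
  define U where "U = max 3 (4 * J / (d * t\<^sub>1))"
  show ?thesis
  proof (rule exI[of _ U], rule exI[of _ "t\<^sub>1 / 4"], intro conjI allI impI)
    fix u assume "U \<le> u"
    then have u: "3 \<le> u" "4 * J / (d * t\<^sub>1) \<le> u" by (auto simp: U_def)
    have "exp (- (u * d)) * (u * d) \<le> 1"
      using less_imp_le[OF less_le_trans[OF less_add_one exp_ge_add_one_self[of "u * d", unfolded add.commute[of 1]]]]
      by (simp add: exp_minus field_simps)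
    then have "exp (- (u * d)) * (u * d) * J \<le> 1 * J" by (rule mult_right_mono) (rule J)
    moreover have "4 * J \<le> u * d * t\<^sub>1" using u(2) d t1 by (simp add: field_simps)
    ultimately have "(u * d) * (exp (- (u * d)) * J) \<le> (u * d) * (t\<^sub>1 / 4)" by (simp add: mult_ac)
    then have small: "exp (- (u * d)) * J \<le> t\<^sub>1 / 4"
      using u d by (simp add: mult_le_cancel_left)
    have "exp (- (u - 1) * cosh t\<^sub>0) * bessel_majorant s
        = exp (- u * cosh t\<^sub>1) * (exp (- (u * d)) * J)"
    proof -
      have "exp (- (u - 1) * cosh t\<^sub>0) = exp (- u * cosh t\<^sub>1) * exp (- (u * d)) * exp (cosh t\<^sub>0)"
        unfolding mult_exp_exp by (simp add: d_def algebra_simps)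
      then show ?thesis by (simp add: J_def mult_ac)
    qed
    also have "\<dots> \<le> exp (- u * cosh t\<^sub>1) * (t\<^sub>1 / 4)"
      by (intro mult_left_mono small) auto
    finally have low: "t\<^sub>1 / 4 * exp (- u * cosh t\<^sub>1) \<le> Re (bessel_K s u)"
      using Re_bessel_K_ge[OF t1 t0(3), of u] u by (simp add: algebra_simps)
    have "exp (- (3 / 2) * u) \<le> exp (- u * cosh t\<^sub>1)"
    proof -
      have "cosh t\<^sub>1 \<le> 3 / 2" using t0 d by (simp add: d_def)
      then have "u * cosh t\<^sub>1 \<le> u * (3 / 2)" using u by (intro mult_left_mono) auto
      then show ?thesis by simp
    qed
    then have "t\<^sub>1 / 4 * exp (- (3 / 2) * u) \<le> t\<^sub>1 / 4 * exp (- u * cosh t\<^sub>1)"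
      using t1 by (intro mult_left_mono) auto
    then show "t\<^sub>1 / 4 * exp (- (3 / 2) * u) \<le> norm (bessel_K s u)"
      using low complex_Re_le_cmod[of "bessel_K s u"] by linarith
  qed (use t1 in \<open>auto simp: U_def\<close>)
qed

lemma summable_on_exp_abs_int:
  assumes "c > (0 :: real)"
  shows "(\<lambda>n::int. exp (- (c * of_int \<bar>n\<bar>))) summable_on UNIV"
proof -
  have "(\<lambda>n::nat. exp (- (c * real n))) = (\<lambda>n. exp (- c) ^ n)"
    by (simp add: exp_of_nat_mult[symmetric] mult_ac)
  then have nat: "(\<lambda>n::nat. exp (- (c * real n))) summable_on UNIV"
    using assms summable_geometric[of "exp (- c)"] by (simp add: summable_on_UNIV_nonneg_real_iff)
  have "(\<lambda>n::int. exp (- (c * of_int \<bar>n\<bar>))) summable_on range int"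
    by (subst summable_on_reindex) (use nat in \<open>auto simp: o_def\<close>)
  moreover have "(\<lambda>n::int. exp (- (c * of_int \<bar>n\<bar>))) summable_on range (\<lambda>n. - int n)"
    by (subst summable_on_reindex) (use nat in \<open>auto simp: o_def inj_on_def\<close>)
  ultimately have "(\<lambda>n::int. exp (- (c * of_int \<bar>n\<bar>))) summable_on (range int \<union> range (\<lambda>n. - int n))"
    by (rule summable_on_union)
  also have "range int \<union> range (\<lambda>n. - int n) = UNIV"
    by (auto simp: image_iff intro: int_cases2)
  finally show ?thesis .
qed

section \<open>Bessel weights on bilinear forms\<close>

lemma abs_exp_minus_one_le: "\<bar>exp x - 1\<bar> \<le> exp \<bar>x\<bar> - (1 :: real)"
proof (cases "x \<ge> 0")
  case False
  have "2 \<le> exp x + exp (- x)" using cosh_real_ge_1[of x] by (simp add: cosh_def)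
  then show ?thesis using False by simp
qed simp

text \<open>
  Linear in \<open>\<delta>\<close>, at the price of \<open>exp (2 * c)\<close>, which the factor \<open>exp (- U * c)\<close> with \<open>U \<ge> 3\<close> pays for.
\<close>
lemma exp_minus_one_le_linear:
  assumes "0 \<le> \<delta>" "\<delta> \<le> 1 / 2" "1 \<le> c"
  shows "exp (2 * \<delta> * c) - 1 \<le> 2 * \<delta> * exp (2 * c :: real)"
proof -
  have "1 - 2 * \<delta> * c \<le> exp (- (2 * \<delta> * c))" using exp_ge_add_one_self[of "- (2 * \<delta> * c)"] by simp
  then have "exp (2 * \<delta> * c) - 1 \<le> 2 * \<delta> * c * exp (2 * \<delta> * c)"
    by (simp add: exp_minus field_simps)
  also have "\<dots> \<le> 2 * \<delta> * exp c * exp c"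
  proof (intro mult_mono)
    show "c \<le> exp c" using exp_ge_add_one_self[of c] by linarith
    show "exp (2 * \<delta> * c) \<le> exp c" using assms mult_right_mono[of "2 * \<delta>" 1 c] by simp
  qed (use assms in auto)
  also have "\<dots> = 2 * \<delta> * exp (2 * c)" by (simp add: mult_exp_exp mult.assoc)
  finally show ?thesis .
qed

text \<open>
  With \<open>P n = exp (- p n * c)\<close> and \<open>Q m = exp (- q m * c)\<close>, the weight \<open>P * Q - 1\<close> is the sum
  \<open>(P - 1) * Q + (Q - 1)\<close> of two product weights.
\<close>
lemma bilinear_bound_exp_deviation:
  assumes B: "bilinear_bound D E B \<beta>" "0 \<le> \<beta>"
    and p: "\<And>n. n \<in> D \<Longrightarrow> \<bar>p n\<bar> \<le> \<delta>" and q: "\<And>m. m \<in> E \<Longrightarrow> \<bar>q m\<bar> \<le> \<delta>"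
    and \<delta>: "0 \<le> \<delta>" and c: "0 \<le> c"
  shows "bilinear_bound D E (\<lambda>n m. of_real (exp (- (p n + q m) * c) - 1) * B n m)
           ((exp (2 * \<delta> * c) - 1) * \<beta>)"
proof -
  define P where "P n = exp (- p n * c)" for n
  define Q where "Q m = exp (- q m * c)" for m
  have bnd: "\<bar>exp (- x * c)\<bar> \<le> exp (\<delta> * c)" "\<bar>exp (- x * c) - 1\<bar> \<le> exp (\<delta> * c) - 1"
    if "\<bar>x\<bar> \<le> \<delta>" for x
  proof -
    have "\<bar>x * c\<bar> \<le> \<delta> * c" using that c by (simp add: abs_mult mult_right_mono)
    then have "exp \<bar>- x * c\<bar> \<le> exp (\<delta> * c)" by simp
    moreover have "exp (- x * c) \<le> exp \<bar>- x * c\<bar>" by (simp only: exp_le_cancel_iff abs_ge_self)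
    moreover have "\<bar>exp (- x * c) - 1\<bar> \<le> exp \<bar>- x * c\<bar> - 1" by (rule abs_exp_minus_one_le)
    ultimately show "\<bar>exp (- x * c)\<bar> \<le> exp (\<delta> * c)" "\<bar>exp (- x * c) - 1\<bar> \<le> exp (\<delta> * c) - 1"
      unfolding abs_exp_cancel by linarith+
  qed
  have nn: "0 \<le> exp (\<delta> * c) - 1" using \<delta> c by simp
  have "bilinear_bound D E (\<lambda>n m. of_real (P n - 1) * of_real (Q m) * B n m)
      ((exp (\<delta> * c) - 1) * exp (\<delta> * c) * \<beta>)"
    by (rule bilinear_bound_weight[OF B])
       (use bnd p q nn in \<open>auto simp: P_def Q_def norm_of_real simp del: of_real_diff of_real_exp\<close>)
  moreover have "bilinear_bound D E (\<lambda>n m. 1 * of_real (Q m - 1) * B n m)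
      (1 * (exp (\<delta> * c) - 1) * \<beta>)"
    by (rule bilinear_bound_weight[OF B])
       (use bnd p q nn in \<open>auto simp: P_def Q_def norm_of_real simp del: of_real_diff of_real_exp\<close>)
  ultimately show ?thesis
  proof (rule bilinear_bound_cong[OF bilinear_bound_add])
    fix n m
    have PQ: "exp (- (p n + q m) * c) = P n * Q m"
      by (simp add: P_def Q_def mult_exp_exp algebra_simps)
    show "of_real (P n - 1) * of_real (Q m) * B n m + 1 * of_real (Q m - 1) * B n m
        = of_real (exp (- (p n + q m) * c) - 1) * B n m"
      unfolding PQ by (simp add: algebra_simps)
    have "exp (2 * \<delta> * c) = exp (\<delta> * c) * exp (\<delta> * c)" by (simp add: mult_exp_exp)
    then show "(exp (\<delta> * c) - 1) * exp (\<delta> * c) * \<beta> + 1 * (exp (\<delta> * c) - 1) * \<beta>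
        = (exp (2 * \<delta> * c) - 1) * \<beta>"
      by (simp add: algebra_simps)
  qed
qed

text \<open>
  The Bessel function is an average of the exponentials \<open>exp (- u * cosh t)\<close>, so its variation near
  \<open>U\<close> is an average of the weights of \<open>bilinear_bound_exp_deviation\<close>, whose bounds are proportional to \<open>\<delta>\<close>
  by \<open>exp_minus_one_le_linear\<close>.
\<close>
lemma bilinear_bound_bessel_deviation:
  assumes fin: "finite D" "finite E"
    and B: "bilinear_bound D E B \<beta>" "0 \<le> \<beta>"
    and p: "\<And>n. n \<in> D \<Longrightarrow> \<bar>p n\<bar> \<le> \<delta>" and q: "\<And>m. m \<in> E \<Longrightarrow> \<bar>q m\<bar> \<le> \<delta>"
    and \<delta>: "0 \<le> \<delta>" "\<delta> \<le> 1 / 2" and U: "3 \<le> U"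
  shows "bilinear_bound D E (\<lambda>n m. B n m * (bessel_K s (U + p n + q m) - bessel_K s U))
           (\<beta> * (2 * \<delta> * bessel_majorant s))"
proof -
  define K where "K t n m = of_real (exp (- U * cosh t)) * cosh (s * of_real t) *
      (of_real (exp (- (p n + q m) * cosh t) - 1) * B n m)" for t n m
  have K: "((\<lambda>t. K t n m) has_integral (B n m * (bessel_K s (U + p n + q m) - bessel_K s U))) {0..}"
    if "n \<in> D" "m \<in> E" for n m
  proof -
    have pos: "0 < U + p n + q m" using p[OF that(1)] q[OF that(2)] \<delta> U by linarith
    have "((\<lambda>t. B n m * (of_real (exp (- (U + p n + q m) * cosh t)) * cosh (s * of_real t)
          - of_real (exp (- U * cosh t)) * cosh (s * of_real t))) has_integral
          (B n m * (bessel_K s (U + p n + q m) - bessel_K s U))) {0..}"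
      unfolding bessel_K_def using pos U
      by (intro has_integral_mult_right has_integral_diff integrable_integral integrable_bessel_integrand) auto
    moreover have "B n m * (of_real (exp (- (U + p n + q m) * cosh t)) * cosh (s * of_real t)
          - of_real (exp (- U * cosh t)) * cosh (s * of_real t)) = K t n m" for t
    proof -
      have "exp (- (U + p n + q m) * cosh t) = exp (- U * cosh t) * exp (- (p n + q m) * cosh t)"
        unfolding mult_exp_exp by (simp add: algebra_simps)
      then show ?thesis by (simp add: K_def algebra_simps)
    qed
    ultimately show ?thesis by simp
  qed
  have "bilinear_bound D E (\<lambda>n m. integral {0..} (\<lambda>t. K t n m))
      (integral {0..} (\<lambda>t. \<beta> * (2 * \<delta> * exp (norm s * t - cosh t))))"
  proof (rule bilinear_bound_integral[OF fin])
    fix t :: real assume "t \<in> {0..}"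
    then have t: "0 \<le> t" by simp
    let ?z = "of_real (exp (- U * cosh t)) * cosh (s * of_real t) :: complex"
    have c: "1 \<le> cosh t" by (rule cosh_real_ge_1)
    have nn: "0 \<le> exp (2 * \<delta> * cosh t) - 1" using \<delta> by simp
    have "bilinear_bound D E (K t) (norm ?z * ((exp (2 * \<delta> * cosh t) - 1) * \<beta>))"
      unfolding K_def
      by (rule bilinear_bound_scale[OF bilinear_bound_exp_deviation[OF B p q \<delta>(1)]])
         (use nn B in auto)
    moreover have "norm ?z * ((exp (2 * \<delta> * cosh t) - 1) * \<beta>) \<le> \<beta> * (2 * \<delta> * exp (norm s * t - cosh t))"
    proof -
      have "norm ?z * (exp (2 * \<delta> * cosh t) - 1)
          \<le> exp (norm s * t - U * cosh t) * (2 * \<delta> * exp (2 * cosh t))"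
        using norm_bessel_integrand_le[OF t] exp_minus_one_le_linear[OF \<delta> c] nn
        by (intro mult_mono) auto
      also have "\<dots> = 2 * \<delta> * exp (norm s * t - U * cosh t + 2 * cosh t)"
        by (simp add: mult_exp_exp mult_ac)
      also have "\<dots> \<le> 2 * \<delta> * exp (norm s * t - cosh t)"
      proof (rule mult_left_mono)
        have "3 * cosh t \<le> U * cosh t" using U by (intro mult_right_mono) auto
        then show "exp (norm s * t - U * cosh t + 2 * cosh t) \<le> exp (norm s * t - cosh t)" by simp
      qed (use \<delta> in simp)
      finally have "norm ?z * (exp (2 * \<delta> * cosh t) - 1) \<le> 2 * \<delta> * exp (norm s * t - cosh t)" .
      from mult_left_mono[OF this B(2)] show ?thesis by (simp only: mult_ac)
    qed
    ultimately show "bilinear_bound D E (K t) (\<beta> * (2 * \<delta> * exp (norm s * t - cosh t)))"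
      by (rule bilinear_bound_mono)
  next
    show "(\<lambda>t. \<beta> * (2 * \<delta> * exp (norm s * t - cosh t))) integrable_on {0..}"
      by (intro integrable_on_mult_right has_integral_integrable[OF has_integral_bessel_majorant])
  qed (use K in \<open>blast intro: has_integral_integrable\<close>)
  then show ?thesis
  proof (rule bilinear_bound_cong)
    show "integral {0..} (\<lambda>t. \<beta> * (2 * \<delta> * exp (norm s * t - cosh t))) = \<beta> * (2 * \<delta> * bessel_majorant s)"
      by (intro integral_unique has_integral_mult_right has_integral_bessel_majorant)
  qed (rule integral_unique[OF K])
qed

section \<open>Coefficients of Maass forms\<close>

text \<open>
  The terms of the Fourier expansion at height \<open>1 / 4\<close> are bounded, and for large \<open>n\<close> the Bessel
  factor \<open>bessel_K (\<i> * \<nu>) (pi / 2 * n)\<close> can be divided out by its lower bound, whose exponent is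
  \<open>3 / 2 * (pi / 2)\<close>. Bessel zeros can only spoil finitely many \<open>n\<close>.
\<close>
lemma maass_coeff_exp_bound:
  assumes A: "maass_fourier_coeffs \<nu> f A"
  shows "\<exists>B\<ge>0. \<forall>n. n \<noteq> 0 \<longrightarrow> norm (A n) \<le> B * exp (3 / 4 * pi * of_int \<bar>n\<bar>)"
proof -
  let ?K = "bessel_K (\<i> * \<nu>)"
  obtain U c where U: "3 \<le> U" "0 < c" "\<And>u. u \<ge> U \<Longrightarrow> c * exp (- (3 / 2) * u) \<le> norm (?K u)"
    using norm_bessel_K_ge by blast
  let ?t = "\<lambda>n. 2 * of_real (sqrt (1 / 4)) * (A n * ?K (2 * pi * of_int \<bar>n\<bar> * (1 / 4)) * e_char (of_int n * of_real 0))"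
  have "(?t has_sum f (Complex 0 (1 / 4))) {n::int. n \<noteq> 0}"
    using A unfolding maass_fourier_coeffs_def by (elim conjE, elim allE[of _ 0] allE[of _ "1 / 4"]) simp
  then have "(\<lambda>n. norm (?t n)) summable_on {n. n \<noteq> 0}"
    by (intro summable_on_iff_abs_summable_on_complex[THEN iffD1] has_sum_imp_summable)
  then obtain G where G: "((\<lambda>n. norm (?t n)) has_sum G) {n. n \<noteq> 0}"
    by (auto simp: summable_on_def)
  have AK: "norm (A n) * norm (?K (pi / 2 * of_int \<bar>n\<bar>)) \<le> G" if "n \<noteq> 0" for n
    using finite_sum_le_has_sum[OF G, of "{n}"] that
    by (simp add: norm_mult e_char_def real_sqrt_divide mult_ac)
  have G0: "G \<ge> 0" using has_sum_nonneg[OF G] by simp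
  define F where "F = {n::int. pi / 2 * of_int \<bar>n\<bar> < U}"
  have "F \<subseteq> {- \<lceil>U\<rceil>..\<lceil>U\<rceil>}"
  proof
    fix n assume "n \<in> F"
    then have "pi / 2 * of_int \<bar>n\<bar> < U" by (simp add: F_def)
    moreover have "1 * of_int \<bar>n\<bar> \<le> pi / 2 * of_int \<bar>n\<bar>"
      using pi_gt3 by (intro mult_right_mono) auto
    ultimately have "of_int \<bar>n\<bar> < U" by simp
    then have "\<bar>n\<bar> \<le> \<lceil>U\<rceil>" by linarith
    then show "n \<in> {- \<lceil>U\<rceil>..\<lceil>U\<rceil>}" by auto
  qed
  then have F: "finite F" by (rule finite_subset) simp
  define B where "B = G / c + (\<Sum>n\<in>F. norm (A n))"
  have Bs: "0 \<le> G / c" "0 \<le> (\<Sum>n\<in>F. norm (A n))" using G0 U by (auto intro!: sum_nonneg)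
  show ?thesis
  proof (intro exI[of _ B] conjI allI impI)
    show "0 \<le> B" using Bs by (simp add: B_def)
    fix n :: int assume n: "n \<noteq> 0"
    let ?e = "exp (3 / 4 * pi * of_int \<bar>n\<bar>) :: real"
    have e: "1 \<le> ?e" by simp
    show "norm (A n) \<le> B * ?e"
    proof (cases "n \<in> F")
      case True
      have "norm (A n) \<le> (\<Sum>n\<in>F. norm (A n))" by (rule member_le_sum[OF True]) (use F in auto)
      also have "\<dots> \<le> B * 1" using Bs by (simp add: B_def)
      also have "\<dots> \<le> B * ?e" using Bs e by (intro mult_left_mono) (auto simp: B_def)
      finally show ?thesis .
    next
      case False
      then have "U \<le> pi / 2 * of_int \<bar>n\<bar>" by (simp add: F_def)
      from U(3)[OF this] have "norm (A n) * (c * exp (- (3 / 2) * (pi / 2 * of_int \<bar>n\<bar>))) \<le> G"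
        using AK[OF n] by (meson mult_left_mono norm_ge_zero order_trans)
      moreover have "exp (- (3 / 2) * (pi / 2 * of_int \<bar>n\<bar>)) = inverse ?e"
        by (simp add: exp_minus[symmetric])
      ultimately have "norm (A n) * (c * inverse ?e) \<le> G" by (simp only:)
      moreover have "a \<le> G / c * e" if "a * (c * inverse e) \<le> G" "0 < e" for a e :: real
        using that U(2) by (simp add: field_simps)
      ultimately have "norm (A n) \<le> G / c * ?e" by simp
      also have "\<dots> \<le> B * ?e" using Bs by (intro mult_right_mono) (auto simp: B_def)
      finally show ?thesis .
    qed
  qed
qed

text \<open>
  At height \<open>y \<ge> 1 / 2\<close> the Bessel factors decay at least like \<open>exp (- pi * n)\<close>, which beats the
  possible growth \<open>exp (3 / 4 * pi * n)\<close> of the coefficients. The excess \<open>exp (- 2 * pi * n * (y - 1 / 2))\<close>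
  absorbs the factor \<open>sqrt y\<close>.
\<close>
lemma maass_bounded_high:
  assumes A: "maass_fourier_coeffs \<nu> f A"
  shows "\<exists>C\<ge>0. \<forall>z. Im z \<ge> 1 / 2 \<longrightarrow> norm (f z) \<le> C"
proof -
  let ?K = "bessel_K (\<i> * \<nu>)" and ?J = "bessel_majorant (\<i> * \<nu>)"
  obtain B where B: "B \<ge> 0" "\<And>n. n \<noteq> 0 \<Longrightarrow> norm (A n) \<le> B * exp (3 / 4 * pi * of_int \<bar>n\<bar>)"
    using maass_coeff_exp_bound[OF A] by blast
  have J: "?J \<ge> 0" by (rule bessel_majorant_nonneg)
  let ?g = "\<lambda>n::int. 2 * B * ?J * exp 1 * exp (- (pi / 4 * of_int \<bar>n\<bar>))"
  have "(\<lambda>n::int. exp (- (pi / 4 * of_int \<bar>n\<bar>))) summable_on {n. n \<noteq> 0}"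
    by (rule summable_on_subset_banach[OF summable_on_exp_abs_int]) auto
  then have "?g summable_on {n. n \<noteq> 0}" by (rule summable_on_cmult_right)
  then obtain C where C: "(?g has_sum C) {n. n \<noteq> 0}" by (auto simp: summable_on_def)
  show ?thesis
  proof (intro exI[of _ C] conjI allI impI)
    show "0 \<le> C" using has_sum_nonneg[OF C] B J by simp
    fix z assume z: "Im z \<ge> 1 / 2"
    define x y where "x = Re z" and "y = Im z"
    have y: "y \<ge> 1 / 2" using z by (simp add: y_def)
    have "((\<lambda>n. 2 * of_real (sqrt y) * (A n * ?K (2 * pi * of_int \<bar>n\<bar> * y) * e_char (of_int n * of_real x)))
          has_sum f (Complex x y)) {n::int. n \<noteq> 0}"
      using A y unfolding maass_fourier_coeffs_def by simp
    then have "norm (f (Complex x y)) \<le> C"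
    proof (rule norm_infsum_le[OF _ C])
      fix n :: int assume "n \<in> {n. n \<noteq> 0}"
      then have n: "n \<noteq> 0" "1 \<le> real_of_int \<bar>n\<bar>" by auto
      let ?N = "real_of_int \<bar>n\<bar>"
      have "1 * (1 / 2) \<le> ?N * y" using n y by (intro mult_mono) auto
      then have "1 \<le> 2 * pi * (?N * y)"
        using pi_gt3 mult_mono[of 6 "2 * pi" "1 / 2" "?N * y"] by simp
      then have K: "norm (?K (2 * pi * ?N * y)) \<le> exp (1 - 2 * pi * ?N * y) * ?J"
        by (intro norm_bessel_K_le) (simp add: mult_ac)
      have "sqrt y \<le> exp (y - 1 / 2)"
      proof (rule real_le_lsqrt)
        have "y \<le> 1 + (2 * y - 1)" using y by simp
        also have "\<dots> \<le> exp (2 * y - 1)" by (rule exp_ge_add_one_self)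
        also have "\<dots> = (exp (y - 1 / 2))\<^sup>2" by (simp add: power2_eq_square mult_exp_exp)
        finally show "y \<le> (exp (y - 1 / 2))\<^sup>2" .
      qed (use y in auto)
      also have "\<dots> \<le> exp (2 * pi * ?N * (y - 1 / 2))"
      proof -
        have "1 * (y - 1 / 2) \<le> 2 * pi * ?N * (y - 1 / 2)"
          using y n pi_gt3 mult_mono[of 1 "2 * pi" 1 ?N] by (intro mult_right_mono) auto
        then show ?thesis by simp
      qed
      finally have sq: "sqrt y \<le> exp (2 * pi * ?N * (y - 1 / 2))" .
      have "norm (2 * of_real (sqrt y) * (A n * ?K (2 * pi * of_int \<bar>n\<bar> * y) * e_char (of_int n * of_real x)))
          = 2 * (sqrt y * (norm (A n) * norm (?K (2 * pi * ?N * y))))"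
        using y by (simp add: norm_mult e_char_def)
      also have "\<dots> \<le> 2 * (exp (2 * pi * ?N * (y - 1 / 2)) *
          ((B * exp (3 / 4 * pi * ?N)) * (exp (1 - 2 * pi * ?N * y) * ?J)))"
        using K sq B n y J by (intro mult_left_mono mult_mono) auto
      also have "\<dots> = 2 * B * ?J * (exp (2 * pi * ?N * (y - 1 / 2)) * exp (3 / 4 * pi * ?N) * exp (1 - 2 * pi * ?N * y))"
        by (simp only: mult_ac)
      also have "exp (2 * pi * ?N * (y - 1 / 2)) * exp (3 / 4 * pi * ?N) * exp (1 - 2 * pi * ?N * y)
          = exp 1 * exp (- (pi / 4 * ?N))"
        unfolding mult_exp_exp by (simp add: algebra_simps)
      finally show "norm (2 * of_real (sqrt y) * (A n * ?K (2 * pi * of_int \<bar>n\<bar> * y) * e_char (of_int n * of_real x)))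
          \<le> ?g n" by (simp add: mult.assoc)
    qed
    then show "norm (f z) \<le> C" by (simp add: x_def y_def)
  qed
qed

text \<open>
  The height \<open>y\<close> is chosen so that \<open>2 * pi * (n + m) * y = U\<close> at the centre \<open>(n\<^sub>0, m\<^sub>0)\<close>. On the block
  the Bessel weight then differs from the nonzero constant \<open>bessel_K (\<i> * \<nu>) U\<close> by a weight of at
  most half its norm, and \<open>bilinear_bound_divide_weight\<close> removes it.
\<close>
lemma maass_hankel_block:
  assumes f: "\<And>z. z \<in> uhp \<Longrightarrow> norm (f z) \<le> C" and A: "maass_fourier_coeffs \<nu> f A"
    and U: "3 \<le> U" "bessel_K (\<i> * \<nu>) U \<noteq> 0"
    and \<delta>: "0 \<le> \<delta>" "\<delta> \<le> 1 / 2" "2 * \<delta> * bessel_majorant (\<i> * \<nu>) \<le> norm (bessel_K (\<i> * \<nu>) U) / 2"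
    and fin: "finite D" "finite E" and N: "0 < n\<^sub>0 + m\<^sub>0"
    and D: "\<And>n. n \<in> D \<Longrightarrow> 0 < n \<and> U * \<bar>of_int n - n\<^sub>0\<bar> \<le> \<delta> * (n\<^sub>0 + m\<^sub>0)"
    and E: "\<And>m. m \<in> E \<Longrightarrow> 0 < m \<and> U * \<bar>of_int m - m\<^sub>0\<bar> \<le> \<delta> * (n\<^sub>0 + m\<^sub>0)"
  shows "bilinear_bound D E (\<lambda>n m. A (n + m))
           (C / norm (bessel_K (\<i> * \<nu>) U) * sqrt (2 * pi * (n\<^sub>0 + m\<^sub>0) / U))"
proof -
  let ?K = "bessel_K (\<i> * \<nu>)"
  define y where "y = U / (2 * pi * (n\<^sub>0 + m\<^sub>0))"
  have y: "y > 0" "2 * pi * y * (n\<^sub>0 + m\<^sub>0) = U" using U N by (auto simp: y_def)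
  define p where "p n = 2 * pi * y * (of_int n - n\<^sub>0)" for n :: int
  define q where "q m = 2 * pi * y * (of_int m - m\<^sub>0)" for m :: int
  have small: "\<bar>2 * pi * y * x\<bar> \<le> \<delta>" if "U * \<bar>x\<bar> \<le> \<delta> * (n\<^sub>0 + m\<^sub>0)" for x
  proof -
    have "2 * pi * y = U / (n\<^sub>0 + m\<^sub>0)" by (simp add: y_def)
    then have "\<bar>2 * pi * y * x\<bar> = U * \<bar>x\<bar> / (n\<^sub>0 + m\<^sub>0)" using N U by (simp add: abs_mult)
    also have "\<dots> \<le> \<delta>" using that N by (subst pos_divide_le_eq)
    finally show ?thesis .
  qed
  define a where "a n = (if n = 0 then 0 else 2 * of_real (sqrt y) * (A n * ?K (2 * pi * of_int \<bar>n\<bar> * y)))"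
    for n :: int
  have series: "((\<lambda>n. a n * cis (2 * pi * of_int n * x)) has_sum f (Complex x y)) UNIV" for x
  proof -
    have "((\<lambda>n. 2 * of_real (sqrt y) * (A n * ?K (2 * pi * of_int \<bar>n\<bar> * y) * e_char (of_int n * of_real x)))
          has_sum f (Complex x y)) {n. n \<noteq> 0}"
      using A y unfolding maass_fourier_coeffs_def by simp
    also have "?this \<longleftrightarrow> ?thesis"
      by (rule has_sum_cong_neutral) (auto simp: a_def e_char_def cis_conv_exp mult_ac)
    finally show ?thesis .
  qed
  have "bilinear_bound D E (\<lambda>n m. a (n + m)) C"
    by (rule bilinear_bound_fourier_series[OF fin series f]) (use y in \<open>simp add: uhp_def\<close>)
  moreover have C: "C \<ge> 0" by (rule order.trans[OF norm_ge_zero f[of \<i>]]) (simp add: uhp_def)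
  ultimately have "bilinear_bound D E (\<lambda>n m. of_real (1 / (2 * sqrt y)) * a (n + m))
      (norm (complex_of_real (1 / (2 * sqrt y))) * C)"
    by (rule bilinear_bound_scale)
  then have w: "bilinear_bound D E (\<lambda>n m. A (n + m) * ?K (U + p n + q m)) (C / (2 * sqrt y))"
  proof (rule bilinear_bound_cong)
    fix n m assume "n \<in> D" "m \<in> E"
    then have "n + m > 0" using D E by (simp add: add_pos_pos)
    moreover have "2 * pi * of_int (n + m) * y = U + p n + q m"
      using y(2) by (simp add: p_def q_def algebra_simps)
    ultimately show "of_real (1 / (2 * sqrt y)) * a (n + m) = A (n + m) * ?K (U + p n + q m)"
      using y by (simp add: a_def)
  qed (use y in \<open>simp add: norm_divide norm_mult\<close>)
  have "bilinear_bound D E (\<lambda>n m. A (n + m)) (2 * (C / (2 * sqrt y)) / norm (?K U))"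
  proof (rule bilinear_bound_divide_weight[OF fin w _ U(2)])
    fix \<beta> :: real assume \<beta>: "0 \<le> \<beta>" "bilinear_bound D E (\<lambda>n m. A (n + m)) \<beta>"
    have "bilinear_bound D E (\<lambda>n m. A (n + m) * (?K (U + p n + q m) - ?K U))
        (\<beta> * (2 * \<delta> * bessel_majorant (\<i> * \<nu>)))"
      using bilinear_bound_bessel_deviation[OF fin \<beta>(2,1) _ _ \<delta>(1,2) U(1), of p q] small D E
      by (simp add: p_def q_def)
    then show "bilinear_bound D E (\<lambda>n m. A (n + m) * (?K (U + p n + q m) - ?K U)) (\<beta> * (norm (?K U) / 2))"
      by (rule bilinear_bound_mono) (intro mult_left_mono \<delta> \<beta>)
  qed (use C y in simp)
  moreover have "2 * (C / (2 * sqrt y)) / norm (?K U) = C / norm (?K U) * sqrt (2 * pi * (n\<^sub>0 + m\<^sub>0) / U)"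
    by (simp add: y_def real_sqrt_divide)
  ultimately show ?thesis by simp
qed

text \<open>
  The admissible relative size \<open>\<eta>\<close> of a block depends on \<open>\<nu>\<close> only, so a bounded number of blocks
  of length \<open>\<eta> * X\<close> covers \<open>[X, 2 X]\<close>.
\<close>
lemma maass_hankel_bound:
  assumes mod: "modular_of_weight 0 f" and A: "maass_fourier_coeffs \<nu> f A"
  shows "\<exists>C\<ge>0. \<forall>X\<ge>1. bilinear_bound (dyadic_ints X) (dyadic_ints X) (\<lambda>n m. A (n + m)) (C * sqrt X)"
proof -
  let ?K = "bessel_K (\<i> * \<nu>)" and ?J = "bessel_majorant (\<i> * \<nu>)"
  obtain C where C: "C \<ge> 0" "\<And>z. Im z \<ge> 1 / 2 \<Longrightarrow> norm (f z) \<le> C"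
    using maass_bounded_high[OF A] by blast
  have f: "norm (f z) \<le> C" if "z \<in> uhp" for z
  proof -
    have "Im z powr (of_int 0 / 2) * norm (f z) \<le> C"
      by (rule modular_invariant_bound[OF mod _ that]) (use C(2) in auto)
    then show ?thesis using that by (simp add: uhp_def)
  qed
  obtain U c where U: "3 \<le> U" "0 < c" "\<And>u. u \<ge> U \<Longrightarrow> c * exp (- (3 / 2) * u) \<le> norm (?K u)"
    using norm_bessel_K_ge by blast
  have "0 < c * exp (- (3 / 2) * U)" using U by simp
  also have "\<dots> \<le> norm (?K U)" by (rule U) simp
  finally have KU: "0 < norm (?K U)" .
  have J: "0 \<le> ?J" by (rule bessel_majorant_nonneg)
  \<comment> \<open>The 1 in the denominator only guards against division by zero.\<close>
  define \<delta> where "\<delta> = min (1 / 2) (norm (?K U) / (4 * (?J + 1)))"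
  have \<delta>: "0 < \<delta>" "\<delta> \<le> 1 / 2" "\<delta> \<le> norm (?K U) / (4 * (?J + 1))"
    unfolding \<delta>_def by (rule min.cobounded1 min.cobounded2 | use KU J in simp)+
  have "2 * \<delta> * ?J \<le> 2 * (norm (?K U) / (4 * (?J + 1))) * (?J + 1)"
    using \<delta> J KU by (intro mult_mono) auto
  also have "\<dots> = norm (?K U) / 2" using J by (simp add: field_simps)
  finally have \<delta>J: "2 * \<delta> * ?J \<le> norm (?K U) / 2" .
  define \<eta> where "\<eta> = 2 * \<delta> / U"
  have \<eta>: "\<eta> > 0" "U * \<eta> = 2 * \<delta>" using \<delta> U by (auto simp: \<eta>_def)
  define R where "R = nat \<lfloor>1 / \<eta>\<rfloor>"
  define C' where "C' = C / norm (?K U) * sqrt (8 * pi / U)"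
  have C': "0 \<le> C'" using C KU U by (simp add: C'_def)
  show ?thesis
  proof (intro exI[of _ "(real (R + 1))\<^sup>2 * C'"] conjI allI impI)
    fix X :: real assume X: "X \<ge> 1"
    let ?D = "dyadic_ints X"
    define blk where "blk n = nat \<lfloor>(of_int n / X - 1) / \<eta>\<rfloor>" for n :: int
    define ctr where "ctr p = X * (1 + real p * \<eta>)" for p :: nat
    have blk: "blk n \<le> R \<and> \<bar>of_int n - ctr (blk n)\<bar> \<le> \<eta> * X" if "n \<in> ?D" for n
    proof -
      define x where "x = (of_int n / X - 1) / \<eta>"
      have n: "of_int n = X * (1 + x * \<eta>)" using X \<eta> by (simp add: x_def field_simps)
      have "0 \<le> x" "x \<le> 1 / \<eta>"
        using that X \<eta> by (auto simp: x_def dyadic_ints_def field_simps)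
      then have "real (blk n) \<le> x" "x \<le> real (blk n) + 1" "blk n \<le> R"
        by (auto simp: blk_def R_def x_def[symmetric] intro: nat_mono floor_mono; linarith)+
      then have "0 \<le> x - real (blk n)" "x - real (blk n) \<le> 1" by auto
      moreover have "of_int n - ctr (blk n) = (x - real (blk n)) * (\<eta> * X)"
        by (simp add: n ctr_def algebra_simps)
      ultimately show ?thesis
        using \<open>blk n \<le> R\<close> X \<eta> by (simp add: abs_mult mult_left_le_one_le)
    qed
    have ctr: "X \<le> ctr p" "ctr p \<le> 2 * X" if "p \<le> R" for p
    proof -
      have "real p \<le> 1 / \<eta>" using that \<eta> unfolding R_def by (simp add: le_nat_iff le_floor_iff)
      then have "real p * \<eta> \<le> 1" using \<eta> by (simp add: field_simps)
      then show "X \<le> ctr p" "ctr p \<le> 2 * X"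
        using X \<eta> mult_left_mono[of "real p * \<eta>" 1 X] by (auto simp: ctr_def algebra_simps)
    qed
    have "bilinear_bound ?D ?D (\<lambda>n m. A (n + m)) ((real (card {..R}))\<^sup>2 * (C' * sqrt X))"
    proof (rule bilinear_bound_partition[of _ _ _ blk])
      fix p q assume "p \<in> {..R}" "q \<in> {..R}"
      then have c: "X \<le> ctr p" "ctr p \<le> 2 * X" "X \<le> ctr q" "ctr q \<le> 2 * X" using ctr by auto
      have close: "0 < n \<and> U * \<bar>of_int n - ctr r\<bar> \<le> \<delta> * (ctr p + ctr q)"
        if "n \<in> {n \<in> ?D. blk n = r}" for n r
      proof -
        have "U * \<bar>of_int n - ctr r\<bar> \<le> U * (\<eta> * X)"
          using blk[of n] that U by (intro mult_left_mono) auto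
        also have "\<dots> = \<delta> * (2 * X)" using \<eta>(2) by (simp add: mult_ac)
        also have "\<dots> \<le> \<delta> * (ctr p + ctr q)" using \<delta> c by (intro mult_left_mono) auto
        finally show ?thesis using that X by (auto simp: dyadic_ints_def)
      qed
      have "bilinear_bound {n \<in> ?D. blk n = p} {m \<in> ?D. blk m = q} (\<lambda>n m. A (n + m))
           (C / norm (?K U) * sqrt (2 * pi * (ctr p + ctr q) / U))"
        by (rule maass_hankel_block[OF f A U(1) _ _ \<delta>(2) \<delta>J]) (use KU \<delta> c X close in auto)
      then show "bilinear_bound {n \<in> ?D. blk n = p} {m \<in> ?D. blk m = q} (\<lambda>n m. A (n + m)) (C' * sqrt X)"
      proof (rule bilinear_bound_mono)
        have "2 * pi * (ctr p + ctr q) / U \<le> 2 * pi * (4 * X) / U"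
          using c U by (intro divide_right_mono mult_left_mono) auto
        then have "sqrt (2 * pi * (ctr p + ctr q) / U) \<le> sqrt (8 * pi / U * X)"
          by (intro real_sqrt_le_mono) (simp add: mult_ac)
        then show "C / norm (?K U) * sqrt (2 * pi * (ctr p + ctr q) / U) \<le> C' * sqrt X"
          using C KU unfolding C'_def real_sqrt_mult[of _ X] mult.assoc by (intro mult_left_mono) auto
      qed
    qed (use blk C' X in auto)
    then show "bilinear_bound ?D ?D (\<lambda>n m. A (n + m)) ((real (R + 1))\<^sup>2 * C' * sqrt X)"
      by (simp add: mult.assoc)
  qed (use C' in auto)
qed

section \<open>Representations by alternating sums\<close>

definition alternating_sum :: "nat \<Rightarrow> (nat \<Rightarrow> int) \<Rightarrow> int" where
  "alternating_sum l t = (\<Sum>j<2 ^ l. t (2 * j) - t (2 * j + 1))"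

text \<open>
  Any finite set \<open>V\<close> that contains all values of the alternating sums may serve as the range of
  summation: the image itself when counting, an interval when its cardinality matters.
\<close>
lemma gamma_count_sums:
  assumes S: "finite S" and V: "finite V" "alternating_sum l ` ({..<2 ^ (l + 1)} \<rightarrow>\<^sub>E S) \<subseteq> V"
  shows "(\<Sum>m\<in>V. gamma_count S l m) = card S ^ 2 ^ (l + 1)"
    and "(gamma_norm S l)\<^sup>2 = (\<Sum>m\<in>V. (real (gamma_count S l m))\<^sup>2)"
proof -
  let ?T = "{..<(2::nat) ^ (l + 1)} \<rightarrow>\<^sub>E S"
  have T: "finite ?T" using S by (intro finite_PiE) auto
  have count: "gamma_count S l m = card {t \<in> ?T. alternating_sum l t = m}" for m
    unfolding gamma_count_def alternating_sum_def by (intro arg_cong[where f = card]) auto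
  have "(\<Sum>m\<in>V. gamma_count S l m) = (\<Sum>m\<in>V. \<Sum>t\<in>{t \<in> ?T. alternating_sum l t = m}. 1)"
    by (simp add: count)
  also have "\<dots> = (\<Sum>t\<in>?T. 1)"
    by (rule sum.group[OF T V])
  finally show "(\<Sum>m\<in>V. gamma_count S l m) = card S ^ 2 ^ (l + 1)"
    by (simp add: card_PiE)
  have zero: "gamma_count S l m = 0" if "m \<notin> V" for m
  proof -
    have "{t \<in> ?T. alternating_sum l t = m} = {}" using V that by auto
    then show ?thesis unfolding count by (simp only: card.empty)
  qed
  have "(\<Sum>\<^sub>\<infinity>m\<in>UNIV. (real (gamma_count S l m))\<^sup>2) = (\<Sum>\<^sub>\<infinity>m\<in>V. (real (gamma_count S l m))\<^sup>2)"
    by (rule infsum_cong_neutral) (auto simp: zero)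
  also have "\<dots> = (\<Sum>m\<in>V. (real (gamma_count S l m))\<^sup>2)" using V by simp
  finally show "(gamma_norm S l)\<^sup>2 = (\<Sum>m\<in>V. (real (gamma_count S l m))\<^sup>2)"
    by (simp add: gamma_norm_def sum_nonneg)
qed

lemma gamma_norm_nonneg: "0 \<le> gamma_norm S l"
  unfolding gamma_norm_def by (intro real_sqrt_ge_zero infsum_nonneg) auto

text \<open>
  As \<open>x \<le> x\<^sup>2\<close> for natural numbers, the second moment of the counts is at least their sum. In terms
  of pairs of tuples with equal alternating sum, these are the pairs of equal tuples.
\<close>
lemma gamma_norm_ge_diagonal:
  assumes "finite S"
  shows "real (card S) ^ 2 ^ (l + 1) \<le> (gamma_norm S l)\<^sup>2"
proof -
  let ?V = "alternating_sum l ` ({..<2 ^ (l + 1)} \<rightarrow>\<^sub>E S)"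
  have V: "finite ?V" using assms by (intro finite_imageI finite_PiE) auto
  have "real (card S) ^ 2 ^ (l + 1) = (\<Sum>m\<in>?V. real (gamma_count S l m))"
    using arg_cong[OF gamma_count_sums(1)[OF assms V order.refl], of real]
    by (simp only: of_nat_sum of_nat_power)
  also have "\<dots> \<le> (\<Sum>m\<in>?V. (real (gamma_count S l m))\<^sup>2)"
  proof (rule sum_mono)
    fix m
    have "gamma_count S l m \<le> (gamma_count S l m)\<^sup>2" by (simp add: power2_eq_square)
    then show "real (gamma_count S l m) \<le> (real (gamma_count S l m))\<^sup>2"
      by (simp only: of_nat_le_iff flip: of_nat_power)
  qed
  also have "\<dots> = (gamma_norm S l)\<^sup>2"
    by (rule gamma_count_sums(2)[OF assms V, symmetric]) simp
  finally show ?thesis .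
qed

text \<open>
  Cauchy-Schwarz: the alternating sums all lie in an interval with at most \<open>2 ^ (l + 1) * X + 1\<close> integers.
\<close>
lemma gamma_norm_ge_average:
  assumes S: "S \<subseteq> dyadic_ints X" and X: "1 \<le> X"
  shows "(real (card S) ^ 2 ^ (l + 1))\<^sup>2 \<le> (gamma_norm S l)\<^sup>2 * (2 ^ (l + 1) * X + 1)"
proof -
  have fin: "finite S" using S by (rule finite_subset) simp
  define L where "L = \<lfloor>2 ^ l * X\<rfloor>"
  have L: "0 \<le> L" "of_int L \<le> 2 ^ l * X" using X by (auto simp: L_def)
  let ?V = "{- L..L}"
  have sub: "alternating_sum l ` ({..<2 ^ (l + 1)} \<rightarrow>\<^sub>E S) \<subseteq> ?V"
  proof
    fix m assume "m \<in> alternating_sum l ` ({..<2 ^ (l + 1)} \<rightarrow>\<^sub>E S)"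
    then obtain t where t: "t \<in> {..<2 ^ (l + 1)} \<rightarrow>\<^sub>E S" "m = alternating_sum l t" by auto
    have tS: "X \<le> of_int (t i)" "of_int (t i) \<le> 2 * X" if "i < 2 ^ (l + 1)" for i
    proof -
      have "t i \<in> S" using t(1) that by (auto simp: PiE_def)
      then show "X \<le> of_int (t i)" "of_int (t i) \<le> 2 * X"
        using S by (auto simp: dyadic_ints_def)
    qed
    have "\<bar>real_of_int m\<bar> \<le> (\<Sum>j<2 ^ l. \<bar>real_of_int (t (2 * j) - t (2 * j + 1))\<bar>)"
      unfolding t(2) alternating_sum_def of_int_sum by (rule sum_abs)
    also have "\<dots> \<le> (\<Sum>j<(2::nat) ^ l. X)"
    proof (rule sum_mono)
      fix j :: nat assume "j \<in> {..<2 ^ l}"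
      then have "2 * j < 2 ^ (l + 1)" "2 * j + 1 < 2 ^ (l + 1)" by auto
      from tS[OF this(1)] tS[OF this(2)]
      show "\<bar>real_of_int (t (2 * j) - t (2 * j + 1))\<bar> \<le> X" by auto
    qed
    finally have "\<bar>real_of_int m\<bar> \<le> 2 ^ l * X" by simp
    then have "of_int \<bar>m\<bar> \<le> 2 ^ l * X" by simp
    then have "\<bar>m\<bar> \<le> L" unfolding L_def by (simp only: le_floor_iff)
    then show "m \<in> ?V" by auto
  qed
  have "(real (card S) ^ 2 ^ (l + 1))\<^sup>2 = (\<Sum>m\<in>?V. real (gamma_count S l m))\<^sup>2"
    using arg_cong[OF gamma_count_sums(1)[OF fin _ sub], of real]
    by (simp only: of_nat_sum of_nat_power finite_atLeastAtMost_int)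
  also have "\<dots> \<le> (\<Sum>m\<in>?V. (real (gamma_count S l m))\<^sup>2) * card ?V"
    by (rule sum_squared_le_sum_of_squares)
  also have "(\<Sum>m\<in>?V. (real (gamma_count S l m))\<^sup>2) = (gamma_norm S l)\<^sup>2"
    by (rule gamma_count_sums(2)[OF fin _ sub, symmetric]) simp
  also have "(gamma_norm S l)\<^sup>2 * real (card ?V) \<le> (gamma_norm S l)\<^sup>2 * (2 ^ (l + 1) * X + 1)"
    using L by (intro mult_left_mono) auto
  finally show ?thesis .
qed

lemma power_powr:
  assumes "0 < (x :: real)"
  shows "(x ^ n) powr a = x powr (real n * a)"
  by (simp only: powr_realpow[OF assms, symmetric] powr_powr)

lemma sqrt_card_le_gamma_norm:
  assumes "finite S"
  shows "sqrt (real (card S)) \<le> gamma_norm S l powr (1 / 2 ^ (l + 1))"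
proof -
  let ?M = "real (card S)" and ?P = "(2::nat) ^ (l + 1)" and ?g = "gamma_norm S l"
  show ?thesis
  proof (cases "card S = 0")
    case False
    then have M: "?M > 0" by simp
    have "?g \<noteq> 0"
    proof
      assume "?g = 0"
      then have "?M ^ ?P \<le> 0" using gamma_norm_ge_diagonal[OF assms, of l] by simp
      then show False using zero_less_power[OF M, of ?P] by linarith
    qed
    then have g: "?g > 0" using gamma_norm_nonneg[of S l] by simp
    have "sqrt ?M = (?M ^ ?P) powr (1 / (2 * real ?P))"
      unfolding power_powr[OF M] using M by (simp add: powr_half_sqrt)
    also have "\<dots> \<le> (?g\<^sup>2) powr (1 / (2 * real ?P))"
      using gamma_norm_ge_diagonal[OF assms, of l] by (intro powr_mono2) auto
    also have "\<dots> = ?g powr (1 / real ?P)"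
      unfolding power_powr[OF g] by simp
    finally show ?thesis by simp
  qed simp
qed

lemma card_le_gamma_norm_one:
  assumes S: "S \<subseteq> dyadic_ints X" and X: "1 \<le> X"
  shows "real (card S) \<le> (5 * X) powr (1 / 8) * gamma_norm S 1 powr (1 / 4)"
proof (cases "card S = 0")
  case False
  let ?M = "real (card S)" and ?g = "gamma_norm S 1"
  have M: "?M > 0" using False by simp
  have "(?M ^ 4)\<^sup>2 \<le> ?g\<^sup>2 * (4 * X + 1)"
    using gamma_norm_ge_average[OF S X, of 1] by simp
  also have "\<dots> \<le> ?g\<^sup>2 * (5 * X)" using X by (intro mult_left_mono) auto
  finally have le: "?M ^ 8 \<le> ?g\<^sup>2 * (5 * X)" by (simp flip: power_mult)
  have "?g \<noteq> 0"
  proof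
    assume "?g = 0"
    then have "?M ^ 8 \<le> 0" using le by simp
    then show False using zero_less_power[OF M, of 8] by linarith
  qed
  then have g: "?g > 0" using gamma_norm_nonneg[of S 1] by simp
  have "?M = (?M ^ 8) powr (1 / 8)"
    unfolding power_powr[OF M] using M by simp
  also have "\<dots> \<le> (?g\<^sup>2 * (5 * X)) powr (1 / 8)"
    using le by (intro powr_mono2) auto
  also have "\<dots> = (?g\<^sup>2) powr (1 / 8) * (5 * X) powr (1 / 8)"
    using X by (simp add: powr_mult)
  also have "(?g\<^sup>2) powr (1 / 8) = ?g powr (1 / 4)"
    unfolding power_powr[OF g] by simp
  finally show ?thesis by (simp add: mult.commute)
qed (simp add: mult_nonneg_nonneg)

text \<open>
  For \<open>l \<ge> 2\<close> minimality gives \<open>2 ^ l \<le> k * (1 - \<delta>\<^sub>1) \<le> k / 2\<close>, hence \<open>2 ^ (l + 2) \<le> 2 * k\<close>. For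
  \<open>l = 1\<close> the inequality \<open>8 \<le> 3 * k\<close> fails for \<open>k = 2\<close> only.
\<close>
lemma least_exponent_cases:
  fixes k l :: nat and \<delta>\<^sub>1 :: real
  assumes k: "k > 1" and \<delta>: "\<delta>\<^sub>1 \<ge> 1 / 2"
    and l: "l = (LEAST j. j \<ge> 1 \<and> 2 ^ (j + 1) > real k * (1 - \<delta>\<^sub>1))"
  shows "2 ^ (l + 2) \<le> 3 * k \<or> k = 2 \<and> l = 1"
proof -
  let ?Q = "\<lambda>j::nat. j \<ge> 1 \<and> 2 ^ (j + 1) > real k * (1 - \<delta>\<^sub>1)"
  obtain j :: nat where "real k * (1 - \<delta>\<^sub>1) < 2 ^ j"
    using real_arch_pow[of 2 "real k * (1 - \<delta>\<^sub>1)"] by auto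
  moreover have "(2::real) ^ j \<le> 2 ^ (j + 1 + 1)" by (intro power_increasing) auto
  ultimately have "real k * (1 - \<delta>\<^sub>1) < 2 ^ (j + 1 + 1)" by (rule less_le_trans)
  then have "?Q (j + 1)" by (intro conjI) auto
  then have "?Q l" unfolding l by (rule LeastI)
  then have l1: "l \<ge> 1" by simp
  show ?thesis
  proof (cases "l = 1")
    case True
    then show ?thesis using k by auto
  next
    case False
    then have "1 \<le> l - 1" using l1 by simp
    have "\<not> ?Q (l - 1)" using l1 unfolding l by (intro not_less_Least) auto
    then have "(2::real) ^ l \<le> real k * (1 - \<delta>\<^sub>1)"
      using \<open>1 \<le> l - 1\<close> l1 by simp
    also have "\<dots> \<le> real k * (1 / 2)" using \<delta> by (intro mult_left_mono) auto
    finally have "real (2 ^ (l + 1)) \<le> real k" by simp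
    then have "2 ^ (l + 1) \<le> k" by (simp only: of_nat_le_iff)
    then show ?thesis by simp
  qed
qed

text \<open>
  When \<open>2 ^ (l + 2) \<le> 3 * k\<close> the exponent of \<open>X\<close> is nonnegative and the diagonal solutions suffice.
  When \<open>k = 2\<close> and \<open>l = 1\<close> it is \<open>- 1 / 32\<close>; there the bound by the average, which is \<open>X powr (- 1 / 8)\<close>
  times the full cardinality, wins because \<open>sqrt (card S)\<close> exceeds a constant times \<open>X powr (5 / 32)\<close>.
\<close>
lemma sqrt_card_bound:
  fixes k l :: nat and c\<^sub>1 :: real
  assumes k: "k > 1" and kl: "2 ^ (l + 2) \<le> 3 * k \<or> k = 2 \<and> l = 1" and c1: "c\<^sub>1 > 0"
    and X: "1 \<le> X" and S: "S \<subseteq> dyadic_ints X"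
    and card: "c\<^sub>1 * X powr (1 / real k) \<le> real (card S)"
  shows "sqrt (real (card S)) \<le> (1 + 5 powr (1 / 8) / sqrt c\<^sub>1) *
           (gamma_norm S l powr (1 / 2 ^ (l + 1)) * X powr (3 / 2 ^ (l + 4) - 1 / (4 * real k)))"
    (is "_ \<le> (1 + ?K) * (?G * ?Y)")
  using kl
proof
  have fin: "finite S" using S by (rule finite_subset) simp
  have K: "0 \<le> ?K" using c1 by simp
  assume "2 ^ (l + 2) \<le> 3 * k"
  then have "real (2 ^ (l + 2)) \<le> real (3 * k)" by (simp only: of_nat_le_iff)
  then have "1 / (4 * real k) \<le> 3 / 2 ^ (l + 4)"
    using k by (simp add: field_simps power_add)
  then have "1 \<le> ?Y" using X by (intro ge_one_powr_ge_zero) auto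
  have "sqrt (real (card S)) \<le> ?G * 1" using sqrt_card_le_gamma_norm[OF fin] by simp
  also have "\<dots> \<le> ?G * ?Y" using \<open>1 \<le> ?Y\<close> by (intro mult_left_mono) auto
  also have "\<dots> \<le> (1 + ?K) * (?G * ?Y)" using mult_right_mono[of 1 "1 + ?K" "?G * ?Y"] K by simp
  finally show ?thesis .
next
  assume kl: "k = 2 \<and> l = 1"
  let ?M = "real (card S)"
  \<comment> \<open>The target is \<open>5 / 32 = 1 / 8 + 1 / 32\<close> for the square root of the cardinality.\<close>
  have "c\<^sub>1 * X powr (5 / 16) \<le> c\<^sub>1 * X powr (1 / 2)"
    using c1 X by (intro mult_left_mono powr_mono) auto
  also have "\<dots> \<le> ?M" using card kl by simp
  finally have "sqrt (c\<^sub>1 * X powr (5 / 16)) \<le> sqrt ?M" by (rule real_sqrt_le_mono)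
  moreover have "sqrt (X powr (5 / 16)) = X powr (5 / 32)"
    using X by (simp add: powr_half_sqrt[symmetric] powr_powr)
  ultimately have "sqrt c\<^sub>1 * X powr (5 / 32) * sqrt ?M \<le> sqrt ?M * sqrt ?M"
    by (intro mult_right_mono) (auto simp: real_sqrt_mult)
  also have "\<dots> \<le> (5 * X) powr (1 / 8) * gamma_norm S 1 powr (1 / 4)"
    using card_le_gamma_norm_one[OF S X] by simp
  finally have "sqrt c\<^sub>1 * X powr (5 / 32) * sqrt ?M \<le> 5 powr (1 / 8) * X powr (1 / 8) * gamma_norm S 1 powr (1 / 4)"
    using X by (simp add: powr_mult)
  then have "sqrt ?M \<le> 5 powr (1 / 8) * X powr (1 / 8) * gamma_norm S 1 powr (1 / 4) / (sqrt c\<^sub>1 * X powr (5 / 32))"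
    using c1 X by (subst pos_le_divide_eq) (auto simp: mult_ac)
  also have "\<dots> = ?K * (gamma_norm S 1 powr (1 / 4) * (X powr (1 / 8) / X powr (5 / 32)))"
    by simp
  also have "X powr (1 / 8) / X powr (5 / 32) = X powr (- 1 / 32)"
    by (simp flip: powr_diff)
  also have "gamma_norm S 1 powr (1 / 4) * X powr (- 1 / 32) = ?G * ?Y"
    using kl by simp
  also have "?K * (?G * ?Y) \<le> (1 + ?K) * (?G * ?Y)" by (intro mult_right_mono) auto
  finally show ?thesis .
qed

section \<open>Sums of shifted coefficients\<close>

text \<open>
  The indicator function of \<open>S\<close> as second vector has norm \<open>sqrt (card S)\<close>.
\<close>
lemma norm_sum_shifts_le:
  assumes "bilinear_bound (dyadic_ints X) (dyadic_ints X) (\<lambda>n m. A (n + m)) \<beta>"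
    and S: "S \<subseteq> dyadic_ints X"
  shows "norm (\<Sum>n\<in>dyadic_ints X. \<Sum>m\<in>S. c n * A (n + m)) \<le> \<beta> * seq_norm X c * sqrt (real (card S))"
proof -
  define d where "d m = (if m \<in> S then 1 else 0 :: complex)" for m
  have "(\<Sum>m\<in>dyadic_ints X. c n * d m * A (n + m)) = (\<Sum>m\<in>S. c n * A (n + m))" for n
    using S by (intro sum.mono_neutral_cong_right) (auto simp: d_def)
  moreover have "L2_set (\<lambda>m. norm (d m)) (dyadic_ints X) = sqrt (real (card S))"
  proof -
    have "(\<Sum>m\<in>dyadic_ints X. (norm (d m))\<^sup>2) = (\<Sum>m\<in>S. 1)"
      using S by (intro sum.mono_neutral_cong_right) (auto simp: d_def)
    then show ?thesis by (simp add: L2_set_def)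
  qed
  ultimately show ?thesis
    using bilinear_boundD[OF assms(1), of c d] by (simp add: seq_norm_def L2_set_def)
qed

theorem theorem1p2:
  fixes f :: "complex \<Rightarrow> complex" and A :: "int \<Rightarrow> complex"
    and k l :: nat and \<delta>\<^sub>1 c\<^sub>1 c\<^sub>2 \<epsilon> :: real
  assumes "(\<exists>\<kappa>. hecke_holomorphic_cusp_form \<kappa> f \<and> holomorphic_fourier_coeffs \<kappa> f A) \<or>
           (\<exists>\<nu>. hecke_maass_cusp_form \<nu> f \<and> maass_fourier_coeffs \<nu> f A)"
    and "k > 1"
    and "\<delta>\<^sub>1 \<ge> 1 / 2"
    and "l = (LEAST j. j \<ge> 1 \<and> 2 ^ (j + 1) > real k * (1 - \<delta>\<^sub>1))"
    and "c\<^sub>1 > 0" and "c\<^sub>2 > 0"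
    and "\<epsilon> > 0"
  shows "\<exists>C>0. \<forall>X\<ge>1. \<forall>S c.
           S \<subseteq> dyadic_ints X \<longrightarrow>
           c\<^sub>1 * X powr (1 / real k) \<le> real (card S) \<longrightarrow>
           real (card S) \<le> c\<^sub>2 * X powr (1 / real k) \<longrightarrow>
           norm (\<Sum>n\<in>dyadic_ints X. \<Sum>m\<in>S. c n * A (n + m))
             \<le> C * (seq_norm X c * X powr (1 / 2) *
                    gamma_norm S l powr (1 / 2 ^ (l + 1)) *
                    X powr (3 / 2 ^ (l + 4) - 1 / (4 * real k) + \<epsilon>))"
proof -
  have "\<exists>C\<ge>0. \<forall>X\<ge>1. bilinear_bound (dyadic_ints X) (dyadic_ints X) (\<lambda>n m. A (n + m)) (C * sqrt X)"
    using assms(1) holomorphic_hankel_bound maass_hankel_bound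
    unfolding hecke_holomorphic_cusp_form_def hecke_maass_cusp_form_def by blast
  then obtain C where C: "C \<ge> 0" "\<And>X. X \<ge> 1 \<Longrightarrow>
      bilinear_bound (dyadic_ints X) (dyadic_ints X) (\<lambda>n m. A (n + m)) (C * sqrt X)"
    by blast
  define K where "K = 1 + 5 powr (1 / 8) / sqrt c\<^sub>1"
  have K: "K > 0" using assms(5) unfolding K_def by (intro add_pos_nonneg) auto
  show ?thesis
  proof (intro exI[of _ "(C + 1) * K"] conjI allI impI)
    show "0 < (C + 1) * K" using C K by simp
    fix X :: real and S :: "int set" and c :: "int \<Rightarrow> complex"
    assume X: "1 \<le> X" and S: "S \<subseteq> dyadic_ints X"
      and card: "c\<^sub>1 * X powr (1 / real k) \<le> real (card S)"
    let ?G = "gamma_norm S l powr (1 / 2 ^ (l + 1))" and ?e = "3 / 2 ^ (l + 4) - 1 / (4 * real k)"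
    have nn: "0 \<le> seq_norm X c" by (simp add: seq_norm_def sum_nonneg)
    have "norm (\<Sum>n\<in>dyadic_ints X. \<Sum>m\<in>S. c n * A (n + m))
        \<le> C * sqrt X * seq_norm X c * sqrt (real (card S))"
      by (rule norm_sum_shifts_le[OF C(2)[OF X] S])
    also have "\<dots> \<le> (C + 1) * X powr (1 / 2) * seq_norm X c * (K * (?G * X powr (?e + \<epsilon>)))"
    proof (intro mult_mono)
      have "sqrt (real (card S)) \<le> K * (?G * X powr ?e)"
        unfolding K_def
        by (rule sqrt_card_bound[OF assms(2) least_exponent_cases[OF assms(2,3,4)] assms(5) X S card])
      also have "\<dots> \<le> K * (?G * X powr (?e + \<epsilon>))"
        using K X assms(7) by (intro mult_left_mono powr_mono) auto
      finally show "sqrt (real (card S)) \<le> K * (?G * X powr (?e + \<epsilon>))" .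
    qed (use C X nn in \<open>auto simp: powr_half_sqrt\<close>)
    finally show "norm (\<Sum>n\<in>dyadic_ints X. \<Sum>m\<in>S. c n * A (n + m))
        \<le> (C + 1) * K * (seq_norm X c * X powr (1 / 2) * ?G * X powr (?e + \<epsilon>))"
      by (simp add: mult_ac)
  qed
qed

end
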